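(* Let $(G,q_1)$ and $(\Gamma,q_2)$ be metric groups with $|G|$ even, $|\Gamma|$ odd, and $c:=\mathcal{G}(q_1)=-\mathcal{G}(q_2)$. Let $S'$ be the $J\times J$ matrix defined in the context and let $$N'_{i,j,k}=\sum_{w\in J}\frac{S'_{w,i}S'_{w,j}S'_{w,k}}{S'_{0,w}}\qquad(i,j,k\in J).$$ Then all the numbers $N'_{i,j,k}$ are non-negative integers if and only if $|\Gamma|=|G|-1$ and $G_2\cong\mathbb{Z}_2\times\mathbb{Z}_2$, where $G_2=\{g\in G:2g=0\}$.
   Context: A metric group $(G,q)$ is a finite abelian group $G$ with a map $q:G\to\mathbb{T}=\{z\in\mathbb{C}:|z|=1\}$ such that $q(-g)=q(g)$ and $\langle g,h\rangle=q(g+h)q(g)^{-1}q(h)^{-1}$ is a non-degenerate bicharacter. $\mathcal{G}(q)=\frac{1}{\sqrt{|G|}}\sum_{g\in G}q(g)$. Let $K=G_2$, $a=1/\sqrt{|G|}$, $b=1/\sqrt{|\Gamma|}$. Fix $G_*\subset G$, $\Gamma_*\subset\Gamma$ with $G=K\sqcup G_*\sqcup(-G_* )$, $\Gamma=\{0\}\sqcup\Gamma_*\sqcup(-\Gamma_* )$. Let $J_1=(K\setminus\{0\})\times\{1,-1\}$ and $J=\{0,\pi\}\sqcup J_1\sqcup G_*\sqcup\Gamma_*$. With blocks indexed in order by $\{0\},\{\pi\},J_1,G_*,\Gamma_*$ (rows $0,\pi,(k,\varepsilon),g,\gamma$; columns with primes): $$S'=\begin{pmatrix} \frac{-a+b}{2}&\frac{a+b}{2}&\frac{a}{2}&a&b\\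 \frac{a+b}{2}&\frac{-a+b}{2}&\frac{-a}{2}&-a&b\\ \frac{a}{2}&\frac{-a}{2}&-\frac{a\langle k,k'\rangle+c\varepsilon\varepsilon'q_1(k)\delta_{k,k'}}{2}&-a\langle k,g'\rangle&0\\ a&-a&-a\langle g,k'\rangle&-a(\langle g,g'\rangle+\overline{\langle g,g'\rangle})&0\\ b&b&0&0&b(\langle\gamma,\gamma'\rangle+\overline{\langle\gamma,\gamma'\rangle}) \end{pmatrix}.$$ *)

theory Defs
  imports
    "HOL-Analysis.Analysis"
    "HOL-Library.Product_Plus"
    "HOL-Library.Z2"
begin

definition pairing :: "('g::ab_group_add \<Rightarrow> complex) \<Rightarrow> 'g \<Rightarrow> 'g \<Rightarrow> complex" where
  "pairing q g h = q (g + h) * inverse (q g) * inverse (q h)"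

definition bicharacter :: "('g::ab_group_add \<Rightarrow> 'g \<Rightarrow> complex) \<Rightarrow> bool" where
  "bicharacter B \<longleftrightarrow>
     (\<forall>g h. norm (B g h) = 1) \<and>
     (\<forall>g g' h. B (g + g') h = B g h * B g' h) \<and>
     (\<forall>g h h'. B g (h + h') = B g h * B g h')"

(* One-sided non-degeneracy; this suffices because pairing q is symmetric. *)
definition nondegenerate :: "('g::ab_group_add \<Rightarrow> 'g \<Rightarrow> complex) \<Rightarrow> bool" where
  "nondegenerate B \<longleftrightarrow> (\<forall>g. (\<forall>h. B g h = 1) \<longrightarrow> g = 0)"

(* The underlying finite abelian group is the whole type 'g. *)
definition metric_group :: "('g::{finite,ab_group_add} \<Rightarrow> complex) \<Rightarrow> bool" where
  "metric_group q \<longleftrightarrow>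
     (\<forall>g. norm (q g) = 1) \<and> (\<forall>g. q (- g) = q g) \<and>
     bicharacter (pairing q) \<and> nondegenerate (pairing q)"

definition gauss_sum :: "('g::{finite,ab_group_add} \<Rightarrow> complex) \<Rightarrow> complex" where
  "gauss_sum q = 1 / complex_of_real (sqrt (real CARD('g))) * (\<Sum>g\<in>UNIV. q g)"

definition two_torsion :: "'g::ab_group_add set" where
  "two_torsion = {g. g + g = 0}"

definition add_isomorphic :: "'a::ab_group_add set \<Rightarrow> 'b::ab_group_add set \<Rightarrow> bool" where
  "add_isomorphic A B \<longleftrightarrow>
     (\<exists>f. bij_betw f A B \<and> (\<forall>x\<in>A. \<forall>y\<in>A. f (x + y) = f x + f y))"

definition half_system :: "'g::ab_group_add set \<Rightarrow> 'g set \<Rightarrow> bool" where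
  "half_system K S \<longleftrightarrow>
     UNIV = K \<union> S \<union> uminus ` S \<and>
     K \<inter> S = {} \<and> K \<inter> uminus ` S = {} \<and> S \<inter> uminus ` S = {}"

(* Labels for J; Ix_K k e stands for the pair (k, e) of J_1. *)
datatype ('g, 'h) ix = Ix_0 | Ix_pi | Ix_K 'g int | Ix_G 'g | Ix_Gamma 'h

definition index_set ::
  "'g::ab_group_add set \<Rightarrow> 'h::ab_group_add set \<Rightarrow> ('g, 'h) ix set" where
  "index_set Gs \<Gamma>s =
     {Ix_0, Ix_pi} \<union> {Ix_K k \<epsilon> | k \<epsilon>. k \<in> two_torsion - {0} \<and> \<epsilon> \<in> {1, -1}} \<union>
     Ix_G ` Gs \<union> Ix_Gamma ` \<Gamma>s"

fun S_entry ::
  "complex \<Rightarrow> complex \<Rightarrow> complex \<Rightarrow> ('g::ab_group_add \<Rightarrow> complex) \<Rightarrow> ('h::ab_group_add \<Rightarrow> complex)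
    \<Rightarrow> ('g, 'h) ix \<Rightarrow> ('g, 'h) ix \<Rightarrow> complex" where
  "S_entry a b c q1 q2 Ix_0 Ix_0 = (- a + b) / 2"
| "S_entry a b c q1 q2 Ix_0 Ix_pi = (a + b) / 2"
| "S_entry a b c q1 q2 Ix_0 (Ix_K k' \<epsilon>') = a / 2"
| "S_entry a b c q1 q2 Ix_0 (Ix_G g') = a"
| "S_entry a b c q1 q2 Ix_0 (Ix_Gamma \<gamma>') = b"
| "S_entry a b c q1 q2 Ix_pi Ix_0 = (a + b) / 2"
| "S_entry a b c q1 q2 Ix_pi Ix_pi = (- a + b) / 2"
| "S_entry a b c q1 q2 Ix_pi (Ix_K k' \<epsilon>') = - a / 2"
| "S_entry a b c q1 q2 Ix_pi (Ix_G g') = - a"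
| "S_entry a b c q1 q2 Ix_pi (Ix_Gamma \<gamma>') = b"
| "S_entry a b c q1 q2 (Ix_K k \<epsilon>) Ix_0 = a / 2"
| "S_entry a b c q1 q2 (Ix_K k \<epsilon>) Ix_pi = - a / 2"
| "S_entry a b c q1 q2 (Ix_K k \<epsilon>) (Ix_K k' \<epsilon>') =
     - (a * pairing q1 k k' + c * of_int \<epsilon> * of_int \<epsilon>' * q1 k * of_bool (k = k')) / 2"
| "S_entry a b c q1 q2 (Ix_K k \<epsilon>) (Ix_G g') = - a * pairing q1 k g'"
| "S_entry a b c q1 q2 (Ix_K k \<epsilon>) (Ix_Gamma \<gamma>') = 0"
| "S_entry a b c q1 q2 (Ix_G g) Ix_0 = a"
| "S_entry a b c q1 q2 (Ix_G g) Ix_pi = - a"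
| "S_entry a b c q1 q2 (Ix_G g) (Ix_K k' \<epsilon>') = - a * pairing q1 g k'"
| "S_entry a b c q1 q2 (Ix_G g) (Ix_G g') = - a * (pairing q1 g g' + cnj (pairing q1 g g'))"
| "S_entry a b c q1 q2 (Ix_G g) (Ix_Gamma \<gamma>') = 0"
| "S_entry a b c q1 q2 (Ix_Gamma \<gamma>) Ix_0 = b"
| "S_entry a b c q1 q2 (Ix_Gamma \<gamma>) Ix_pi = b"
| "S_entry a b c q1 q2 (Ix_Gamma \<gamma>) (Ix_K k' \<epsilon>') = 0"
| "S_entry a b c q1 q2 (Ix_Gamma \<gamma>) (Ix_G g') = 0"
| "S_entry a b c q1 q2 (Ix_Gamma \<gamma>) (Ix_Gamma \<gamma>') =
     b * (pairing q2 \<gamma> \<gamma>' + cnj (pairing q2 \<gamma> \<gamma>'))"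

definition S_matrix ::
  "complex \<Rightarrow> ('g::{finite,ab_group_add} \<Rightarrow> complex) \<Rightarrow> ('h::{finite,ab_group_add} \<Rightarrow> complex)
    \<Rightarrow> ('g, 'h) ix \<Rightarrow> ('g, 'h) ix \<Rightarrow> complex" where
  "S_matrix c q1 q2 =
     S_entry (1 / complex_of_real (sqrt (real CARD('g))))
             (1 / complex_of_real (sqrt (real CARD('h)))) c q1 q2"

definition verlinde :: "'i set \<Rightarrow> ('i \<Rightarrow> 'i \<Rightarrow> complex) \<Rightarrow> 'i \<Rightarrow> 'i \<Rightarrow> 'i \<Rightarrow> 'i \<Rightarrow> complex" where
  "verlinde J S z i j k = (\<Sum>w\<in>J. S w i * S w j * S w k / S z w)"

end

theory Submission
  imports Defs
begin

text \<open>Write \<open>n\<close>, \<open>m\<close> for the orders of the two groups. Extend the columns of \<open>S'\<close> to even functions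
  \<open>\<chi>\<^sub>i\<close> on \<open>G\<close> and \<open>\<psi>\<^sub>i\<close> on \<open>\<Gamma>\<close>, and put \<open>d\<^sub>i = \<chi>\<^sub>i(0) + \<psi>\<^sub>i(0) \<in> {0, 1, 2}\<close>. Then \<open>N'\<^sub>i\<^sub>j\<^sub>k\<close> is
  \<open>d\<^sub>i d\<^sub>j d\<^sub>k / (2 (n - m))\<close> minus half the average of \<open>\<chi>\<^sub>i \<chi>\<^sub>j \<chi>\<^sub>k\<close> plus half the average of
  \<open>\<psi>\<^sub>i \<psi>\<^sub>j \<psi>\<^sub>k\<close> plus \<open>c\<^sup>2\<close> times a correction supported on \<open>J\<^sub>1\<close>, and the averages count
  vanishing signed sums of the labels.

  The entry at \<open>(\<pi>, \<pi>, \<pi>)\<close> is \<open>4 / (n - m)\<close> with \<open>n - m\<close> odd, so \<open>n = m + 1\<close>. Three distinct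
  nonzero elements of \<open>K\<close> with nonzero sum give the entry \<open>1/2\<close>, so \<open>|K| \<le> 4\<close>. If \<open>|K| = 2\<close>, the
  entries on \<open>J\<^sub>1\<close> force \<open>c\<^sup>2 = - 1\<close>, which contradicts the value of the Gauss sums.

  For that value, let \<open>E\<close> be the sum of all \<open>\<langle>g, g\<rangle>\<close>. Then \<open>E\<^sup>2\<close> is \<open>n c\<^sup>2\<close> times the same sum over \<open>K\<close>,
  while \<open>E\<close> is the trace of a matrix whose square is \<open>n\<close> times the permutation \<open>g \<mapsto> - g\<close>;
  counting the dimensions of its eigenspaces pins down \<open>E / \<surd>n\<close> modulo parity. For \<open>\<Gamma>\<close> this
  yields \<open>c\<^sup>2 = - 1\<close> exactly when \<open>m \<equiv> 3\<close> modulo \<open>4\<close>; for \<open>|K| = 2\<close> and \<open>4\<close> dividing \<open>n\<close> it excludes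
  \<open>c\<^sup>2 = - 1\<close>.\<close>

section \<open>Metric groups and quadratic Gauss sums\<close>

text \<open>Each non-empty fibre of \<open>u \<mapsto> u + u\<close> is a coset of the two-torsion,
  and the fibres partition the group. Two-torsion of order four thus makes the group order divisible
  by 4.\<close>

lemma card_two_torsion_dvd: "card (two_torsion :: 'a set) dvd CARD('a::{finite,ab_group_add})"
proof -
  have fibre: "card (two_torsion :: 'a set) dvd card {u. u + u = x}" for x :: 'a
  proof (cases "\<exists>u. u + u = x")
    case True
    then obtain u where u: "u + u = x" ..
    have "{v. v + v = x} = (\<lambda>k. u + k) ` two_torsion"
    proof (intro equalityI subsetI)
      fix v assume "v \<in> {v. v + v = x}"
      then have "v - u \<in> two_torsion"
        using u by (simp add: two_torsion_def algebra_simps)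
      moreover have "v = u + (v - u)"
        by simp
      ultimately show "v \<in> (\<lambda>k. u + k) ` two_torsion"
        by blast
    next
      fix v assume "v \<in> (\<lambda>k. u + k) ` two_torsion"
      then obtain k where "k + k = 0" "v = u + k"
        by (auto simp: two_torsion_def)
      then show "v \<in> {v. v + v = x}"
        using u by (simp add: algebra_simps)
    qed
    then show ?thesis
      by (simp add: card_image)
  qed simp
  have "CARD('a) = (\<Sum>x\<in>UNIV. card {u :: 'a. u + u = x})"
    using sum.group[of UNIV UNIV "\<lambda>u::'a. u + u" "\<lambda>_. 1 :: nat"] by simp
  then show ?thesis
    using fibre by (simp add: dvd_sum)
qed

text \<open>The trace of an idempotent is its rank. Induction on the number of nonzero columns:
  splitting off a rank-one idempotent lowers the trace by one.\<close>

lemma idempotent_trace_nat: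
  fixes e :: "'a::finite \<Rightarrow> 'a \<Rightarrow> 'b::field"
  assumes "\<And>g h. (\<Sum>x\<in>UNIV. e g x * e x h) = e g h"
  shows "\<exists>r::nat. (\<Sum>g\<in>UNIV. e g g) = of_nat r"
  using assms
proof (induction "card {h. \<exists>g. e g h \<noteq> 0}" arbitrary: e rule: less_induct)
  case less
  show ?case
  proof (cases "\<forall>g h. e g h = 0")
    case True
    then show ?thesis by (intro exI[of _ 0]) simp
  next
    case False
    then obtain i j where ij: "e i j \<noteq> 0" by blast
    \<comment> \<open>The piece split off is column \<open>j\<close> times row \<open>i\<close>,
      scaled so that column \<open>j\<close> of \<open>e'\<close> vanishes; no new nonzero column
      arises.\<close>
    define e' where "e' g h = e g h - e g j * e i h / e i j" for g h
    have "(\<Sum>x\<in>UNIV. e' g x * e' x h) = e' g h" for g h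
    proof -
      have "(\<Sum>x\<in>UNIV. e' g x * e' x h) =
          (\<Sum>x\<in>UNIV. e g x * e x h - (e i h / e i j) * (e g x * e x j)
             - (e g j / e i j) * (e i x * e x h)
             + (e g j * e i h / (e i j)\<^sup>2) * (e i x * e x j))"
        using ij by (intro sum.cong) (auto simp: e'_def field_simps power2_eq_square)
      also have "\<dots> = e g h - (e i h / e i j) * e g j - (e g j / e i j) * e i h
             + (e g j * e i h / (e i j)\<^sup>2) * e i j"
        by (simp only: sum.distrib sum_subtractf flip: sum_distrib_left) (simp add: less.prems)
      also have "\<dots> = e' g h"
        using ij by (simp add: e'_def field_simps power2_eq_square)
      finally show ?thesis .
    qed
    moreover have "card {h. \<exists>g. e' g h \<noteq> 0} < card {h. \<exists>g. e g h \<noteq> 0}"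
    proof (rule psubset_card_mono)
      have "e' g h = 0" if "\<forall>g. e g h = 0" for g h
        using that by (simp add: e'_def)
      then have "{h. \<exists>g. e' g h \<noteq> 0} \<subseteq> {h. \<exists>g. e g h \<noteq> 0}"
        by blast
      moreover have "\<forall>g. e' g j = 0"
        using ij by (auto simp: e'_def)
      ultimately show "{h. \<exists>g. e' g h \<noteq> 0} \<subset> {h. \<exists>g. e g h \<noteq> 0}"
        using ij by auto
    qed simp
    ultimately obtain r where r: "(\<Sum>g\<in>UNIV. e' g g) = of_nat r"
      using less.hyps by blast
    have "(\<Sum>g\<in>UNIV. e' g g) = (\<Sum>g\<in>UNIV. e g g) - (\<Sum>g\<in>UNIV. e i g * e g j) / e i j"
      by (simp add: e'_def sum_subtractf sum_divide_distrib mult.commute)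
    also have "(\<Sum>g\<in>UNIV. e i g * e g j) / e i j = 1"
      using ij by (simp only: less.prems) simp
    finally have "(\<Sum>g\<in>UNIV. e g g) = of_nat (Suc r)"
      using r by (simp add: algebra_simps)
    then show ?thesis by blast
  qed
qed

lemma card_half_system:
  fixes S :: "'g::{finite,ab_group_add} set"
  assumes "half_system K S"
  shows "CARD('g) = card K + 2 * card S"
proof -
  have "CARD('g) = card (K \<union> S \<union> uminus ` S)"
    using assms by (simp add: half_system_def)
  also have "\<dots> = card K + card S + card (uminus ` S)"
    using assms by (subst card_Un_disjoint; simp add: half_system_def card_Un_disjoint Int_Un_distrib2)
  also have "card (uminus ` S) = card S"
    by (simp add: card_image)
  finally show ?thesis by simp
qed

section \<open>Orthogonality of characters in a metric group\<close>

locale metric_grp =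
  fixes q :: "'g::{finite,ab_group_add} \<Rightarrow> complex"
  assumes mg: "metric_group q"
begin

abbreviation B where "B \<equiv> pairing q"

lemma norm_q [simp]: "norm (q g) = 1"
  and q_minus [simp]: "q (- g) = q g"
  and norm_B [simp]: "norm (B g h) = 1"
  and B_add_left: "B (g + g') h = B g h * B g' h"
  and B_add_right: "B g (h + h') = B g h * B g h'"
  and B_nondegenerate: "(\<And>h. B g h = 1) \<Longrightarrow> g = 0"
  using mg unfolding metric_group_def bicharacter_def nondegenerate_def by auto

lemma q_nonzero [simp]: "q g \<noteq> 0"
  using norm_q[of g] by (metis norm_zero zero_neq_one)

lemma B_nonzero [simp]: "B g h \<noteq> 0"
  using norm_B[of g h] by (metis norm_zero zero_neq_one)

lemma B_commute: "B g h = B h g"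
  by (simp add: pairing_def add.commute mult.commute mult.left_commute)

lemma B_zero [simp]: "B 0 h = 1" "B h 0 = 1"
  using B_add_left[of 0 0 h] B_add_right[of h 0 0] by simp_all

lemma B_minus_left: "B (- g) h = cnj (B g h)"
proof -
  have "B (- g) h * B g h = 1"
    using B_add_left[of "- g" g h] by simp
  moreover have "cnj (B g h) * B g h = 1"
    using complex_norm_square[of "B g h"] by (simp add: mult.commute)
  ultimately show ?thesis
    by (metis B_nonzero mult_right_cancel)
qed

lemma B_minus_right: "B g (- h) = cnj (B g h)"
  using B_minus_left B_commute by metis

lemma B_minus_minus [simp]: "B (- g) (- h) = B g h"
  by (simp add: B_minus_left B_minus_right)

lemma cnj_B: "cnj (B g h) = inverse (B g h)"
  using complex_norm_square[of "B g h"] by (simp add: field_simps)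

lemma q_zero [simp]: "q 0 = 1"
  using B_zero(1)[of 0] by (simp add: pairing_def field_simps)

lemma q_add: "q (g + h) = B g h * q g * q h"
  by (simp add: pairing_def field_simps)

text \<open>Evenness of \<open>q\<close> makes \<open>B g (- g)\<close> the inverse square of
  \<open>q g\<close>, while a minus sign in one argument conjugates, hence inverts,
  \<open>B\<close>.\<close>

lemma B_self: "B g g = (q g)\<^sup>2"
proof -
  have "B g (- g) = inverse ((q g)\<^sup>2)"
    by (simp add: pairing_def power2_eq_square)
  then show ?thesis
    by (metis B_minus_right cnj_B inverse_inverse_eq)
qed

text \<open>For \<open>x \<noteq> 0\<close> a translation by some \<open>h0\<close> multiplies the
  sum by \<open>B x h0 \<noteq> 1\<close>, so the sum vanishes.\<close>

lemma sum_B: "(\<Sum>h\<in>UNIV. B x h) = of_bool (x = 0) * of_nat CARD('g)"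
proof (cases "x = 0")
  case False
  then obtain h0 where h0: "B x h0 \<noteq> 1"
    using B_nondegenerate by blast
  have "(\<Sum>h\<in>UNIV. B x h) = (\<Sum>h\<in>UNIV. B x (h0 + h))"
    by (rule sum.reindex_bij_witness[of _ "\<lambda>h. h0 + h" "\<lambda>h. h - h0"]) auto
  also have "\<dots> = B x h0 * (\<Sum>h\<in>UNIV. B x h)"
    by (simp add: B_add_right sum_distrib_left)
  finally show ?thesis using h0 False by simp
qed simp

text \<open>Replacing \<open>g\<close> by \<open>h + g\<close> turns the summand into
  \<open>q g * B g h\<close>; summing over \<open>h\<close> first leaves only
  \<open>g = 0\<close>.\<close>

lemma sum_q_cnj: "(\<Sum>g\<in>UNIV. q g) * cnj (\<Sum>g\<in>UNIV. q g) = of_nat CARD('g)"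
proof -
  have "(\<Sum>g\<in>UNIV. q g) * cnj (\<Sum>g\<in>UNIV. q g) = (\<Sum>h\<in>UNIV. \<Sum>g\<in>UNIV. q g * cnj (q h))"
    by (simp add: sum_product) (rule sum.swap)
  also have "\<dots> = (\<Sum>h\<in>UNIV. \<Sum>g\<in>UNIV. q (h + g) * cnj (q h))"
  proof (rule sum.cong[OF refl])
    fix h
    show "(\<Sum>g\<in>UNIV. q g * cnj (q h)) = (\<Sum>g\<in>UNIV. q (h + g) * cnj (q h))"
      by (rule sum.reindex_bij_witness[of _ "\<lambda>g. h + g" "\<lambda>g. g - h"]) auto
  qed
  also have "\<dots> = (\<Sum>h\<in>UNIV. \<Sum>g\<in>UNIV. q g * B g h)"
  proof (intro sum.cong refl)
    fix h g
    have "q h * cnj (q h) = 1"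
      using complex_norm_square[of "q h"] by simp
    then show "q (h + g) * cnj (q h) = q g * B g h"
      by (simp add: q_add B_commute[of h g] mult.assoc mult.left_commute[of "q h"])
  qed
  also have "\<dots> = (\<Sum>g\<in>UNIV. q g * (\<Sum>h\<in>UNIV. B g h))"
    by (subst sum.swap) (simp add: sum_distrib_left)
  also have "\<dots> = of_nat CARD('g)"
    by (simp add: sum_B if_distrib if_distribR of_bool_def cong: if_cong)
  finally show ?thesis .
qed

lemma sum_q_eq: "(\<Sum>g\<in>UNIV. q g) = complex_of_real (sqrt (real CARD('g))) * gauss_sum q"
  by (simp add: gauss_sum_def)

lemma norm_gauss_sum: "norm (gauss_sum q) = 1"
proof -
  have "(norm (\<Sum>g\<in>UNIV. q g))\<^sup>2 = real CARD('g)"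
    using sum_q_cnj by (metis complex_norm_square of_real_eq_iff of_real_of_nat_eq)
  then have "real CARD('g) * (norm (gauss_sum q))\<^sup>2 = real CARD('g)"
    by (simp add: sum_q_eq norm_mult power_mult_distrib)
  then show ?thesis
    by (simp add: power2_eq_1_iff) (metis norm_ge_zero not_one_le_zero neg_0_le_iff_le)
qed

lemma B_two_torsion_cases: "k \<in> two_torsion \<Longrightarrow> B k h = 1 \<or> B k h = - 1"
  using B_add_left[of k k h] by (simp add: two_torsion_def square_eq_1_iff)

lemma minus_two_torsion: "k \<in> two_torsion \<Longrightarrow> - k = (k::'g)"
  by (simp add: two_torsion_def minus_unique)

text \<open>The characters \<open>B k\<close> with \<open>k\<close> in the two-torsion are those
  trivial on all doubles. By orthogonality their sum at \<open>x\<close> counts the solutions of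
  \<open>u + u = x\<close>.\<close>

lemma sum_double:
  "(\<Sum>u\<in>UNIV. f (u + u)) = (\<Sum>k\<in>two_torsion. \<Sum>x\<in>UNIV. B k x * f x)"
proof -
  have *: "(\<Sum>k\<in>two_torsion. B k x) = of_nat (card {u. u + u = x})" for x
  proof -
    have "of_nat CARD('g) * (\<Sum>k\<in>two_torsion. B k x) =
        (\<Sum>k\<in>UNIV. of_bool (k + k = 0) * of_nat CARD('g) * B k x)"
      by (simp add: two_torsion_def of_bool_def if_distrib if_distribR sum.If_cases sum_distrib_left
          cong: if_cong)
    also have "\<dots> = (\<Sum>k\<in>UNIV. (\<Sum>u\<in>UNIV. B (k + k) u) * B k x)"
      by (simp add: sum_B)
    also have "\<dots> = (\<Sum>k\<in>UNIV. \<Sum>u\<in>UNIV. B k (u + u + x))"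
      by (simp add: sum_distrib_right B_add_left B_add_right)
    also have "\<dots> = (\<Sum>u\<in>UNIV. \<Sum>k\<in>UNIV. B (u + u + x) k)"
      by (subst sum.swap) (simp add: B_commute)
    also have "\<dots> = of_nat CARD('g) * of_nat (card {u. u + u + x = 0})"
      by (simp add: sum_B of_bool_def if_distrib if_distribR sum.If_cases cong: if_cong)
    also have "card {u. u + u + x = 0} = card {u. u + u = x}"
    proof (rule bij_betw_same_card[of uminus], rule bij_betw_byWitness[of _ uminus])
      have "- u + - u = x" if "u + u + x = 0" for u
        using minus_unique[OF that] by simp
      then show "uminus ` {u. u + u + x = 0} \<subseteq> {u. u + u = x}"
        by auto
    qed auto
    finally show ?thesis by simp
  qed
  have "(\<Sum>u\<in>UNIV. f (u + u)) = (\<Sum>x\<in>UNIV. \<Sum>u\<in>{u. u \<in> UNIV \<and> u + u = x}. f (u + u))"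
    by (rule sum.group[symmetric]) auto
  also have "\<dots> = (\<Sum>x\<in>UNIV. of_nat (card {u. u + u = x}) * f x)"
    by simp
  also have "\<dots> = (\<Sum>k\<in>two_torsion. \<Sum>x\<in>UNIV. B k x * f x)"
    by (simp flip: * add: sum_distrib_right) (rule sum.swap)
  finally show ?thesis .
qed

text \<open>The starting point is \<open>q (u + v) * q (u - v) = B u u * B v v\<close>. With
  \<open>g = u + v\<close> the second factor depends on \<open>u\<close> only through
  \<open>u + u\<close>, so \<open>sum_double\<close> applies; each \<open>k\<close> then contributes
  the square of the Gauss sum twisted by \<open>B k\<close>.\<close>

lemma square_sum_B_self:
  "(\<Sum>g\<in>UNIV. B g g)\<^sup>2 = of_nat CARD('g) * (gauss_sum q)\<^sup>2 * (\<Sum>k\<in>two_torsion. B k k)"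
proof -
  have shift: "(\<Sum>g\<in>UNIV. B k g * q g) = (\<Sum>g\<in>UNIV. q g) / q k" for k
  proof -
    have "(\<Sum>g\<in>UNIV. q g) = (\<Sum>g\<in>UNIV. q (k + g))"
      by (rule sum.reindex_bij_witness[of _ "\<lambda>g. k + g" "\<lambda>g. g - k"]) auto
    also have "\<dots> = q k * (\<Sum>g\<in>UNIV. B k g * q g)"
      by (simp add: q_add sum_distrib_left mult_ac)
    finally show ?thesis by simp
  qed
  \<comment> \<open>\<open>B k k\<close> is a sign, so dividing by the square of \<open>q k\<close>
    is multiplying by \<open>B k k\<close>.\<close>
  have inv: "inverse ((q k)\<^sup>2) = B k k" if "k \<in> two_torsion" for k
    using B_two_torsion_cases[OF that, of k] by (auto simp: B_self)
  have "(\<Sum>g\<in>UNIV. B g g)\<^sup>2 = (\<Sum>u\<in>UNIV. \<Sum>v\<in>UNIV. q (u + v) * q (u - v))"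
  proof -
    have "q (u + v) * q (u - v) = B u u * B v v" for u v
      using q_add[of u v] q_add[of u "- v"]
      by (simp add: B_self B_minus_right cnj_B field_simps power2_eq_square)
    then show ?thesis by (simp add: power2_eq_square sum_product)
  qed
  also have "\<dots> = (\<Sum>u\<in>UNIV. \<Sum>g\<in>UNIV. q g * q (u + u - g))"
  proof (rule sum.cong[OF refl])
    fix u
    show "(\<Sum>v\<in>UNIV. q (u + v) * q (u - v)) = (\<Sum>g\<in>UNIV. q g * q (u + u - g))"
      by (rule sum.reindex_bij_witness[of _ "\<lambda>g. g - u" "\<lambda>v. u + v"]) (auto simp: algebra_simps)
  qed
  also have "\<dots> = (\<Sum>g\<in>UNIV. q g * (\<Sum>u\<in>UNIV. q (u + u - g)))"
    by (subst sum.swap) (simp add: sum_distrib_left)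
  also have "\<dots> = (\<Sum>g\<in>UNIV. q g * (\<Sum>k\<in>two_torsion. \<Sum>x\<in>UNIV. B k x * q (x - g)))"
    by (subst sum_double[where f = "\<lambda>x. q (x - g)" for g]) simp
  also have "\<dots> = (\<Sum>g\<in>UNIV. q g * (\<Sum>k\<in>two_torsion. B k g * (\<Sum>x\<in>UNIV. B k x * q x)))"
  proof (intro sum.cong refl arg_cong2[where f = "(*)"])
    fix g k
    have "(\<Sum>x\<in>UNIV. B k x * q (x - g)) = (\<Sum>x\<in>UNIV. B k (g + x) * q x)"
      by (rule sum.reindex_bij_witness[of _ "\<lambda>x. g + x" "\<lambda>x. x - g"]) auto
    then show "(\<Sum>x\<in>UNIV. B k x * q (x - g)) = B k g * (\<Sum>x\<in>UNIV. B k x * q x)"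
      by (simp add: B_add_right sum_distrib_left mult.assoc)
  qed
  also have "\<dots> = (\<Sum>k\<in>two_torsion. (\<Sum>g\<in>UNIV. B k g * q g)\<^sup>2)"
    unfolding sum_distrib_left[of "q _"]
    by (subst sum.swap) (simp add: power2_eq_square sum_distrib_right sum_distrib_left mult_ac)
  also have "\<dots> = (\<Sum>k\<in>two_torsion. (\<Sum>g\<in>UNIV. q g)\<^sup>2 * B k k)"
    by (intro sum.cong refl) (simp add: shift divide_inverse power_mult_distrib power_inverse inv)
  also have "\<dots> = of_nat CARD('g) * (gauss_sum q)\<^sup>2 * (\<Sum>k\<in>two_torsion. B k k)"
    by (simp add: sum_q_eq power_mult_distrib sum_distrib_left flip: of_real_power)
  finally show ?thesis .
qed

lemma sum_B_mult_B: "(\<Sum>x\<in>UNIV. B g x * B x h) = of_bool (g = - h) * of_nat CARD('g)"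
proof -
  have "(\<Sum>x\<in>UNIV. B g x * B x h) = (\<Sum>x\<in>UNIV. B (g + h) x)"
    by (intro sum.cong refl) (simp add: B_add_left B_commute[of _ h])
  then show ?thesis
    by (simp add: sum_B eq_neg_iff_add_eq_0)
qed

section \<open>Traces of the discrete Fourier transform and squares of Gauss sums\<close>

text \<open>The matrix \<open>F = (B g h / sqrt n)\<close> satisfies \<open>F\<^sup>4 = 1\<close>; the lemma computes the trace of
  the projection onto its eigenspace for \<open>1 / \<omega>\<close>.\<close>

lemma dft_projection_trace:
  assumes w: "\<omega> ^ 4 = 1"
  shows "\<exists>r::nat. of_nat CARD('g) + \<omega> * ((\<Sum>g\<in>UNIV. B g g) / sqrt CARD('g))
      + \<omega>\<^sup>2 * of_nat (card (two_torsion :: 'g set))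
      + \<omega> ^ 3 * (cnj (\<Sum>g\<in>UNIV. B g g) / sqrt CARD('g)) = 4 * of_nat r"
proof -
  define F where "F g h = B g h / complex_of_real (sqrt CARD('g))" for g h
  \<comment> \<open>The square of \<open>F\<close> is the permutation
    \<open>g \<mapsto> - g\<close>, so the four terms are the powers of \<open>\<omega>\<close>
    times \<open>F\<close> with exponents 0 to 3.\<close>
  define e where "e g h = (of_bool (g = h) + \<omega> * F g h + \<omega>\<^sup>2 * of_bool (g = - h) + \<omega> ^ 3 * F g (- h)) / 4"
    for g h
  have FF: "(\<Sum>x\<in>UNIV. F g x * F x h) = of_bool (g = - h)" for g h
  proof -
    have "(\<Sum>x\<in>UNIV. F g x * F x h) = (\<Sum>x\<in>UNIV. B g x * B x h) / of_nat CARD('g)"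
      by (simp add: F_def sum_divide_distrib flip: of_real_mult)
    then show ?thesis by (simp add: sum_B_mult_B)
  qed
  have w5: "\<omega> ^ 5 = \<omega>" and w6: "\<omega> ^ 6 = \<omega>\<^sup>2"
    using w by algebra+
  \<comment> \<open>\<open>F\<close> acts on \<open>e\<close> as the scalar
    \<open>1 / \<omega> = \<omega> ^ 3\<close>, so all four powers fix \<open>e\<close>, and so does
    their average \<open>e\<close>.\<close>
  have Fe: "(\<Sum>x\<in>UNIV. F g x * e x h) = \<omega> ^ 3 * e g h" for g h
  proof -
    have "(\<Sum>x\<in>UNIV. F g x * e x h) =
        (\<Sum>x\<in>UNIV. (F g x * of_bool (x = h) + \<omega> * (F g x * F x h)
          + \<omega>\<^sup>2 * (F g x * of_bool (x = - h)) + \<omega> ^ 3 * (F g x * F x (- h))) / 4)"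
      by (intro sum.cong refl) (simp add: e_def algebra_simps)
    also have "\<dots> =
        ((\<Sum>x\<in>UNIV. F g x * of_bool (x = h)) + \<omega> * (\<Sum>x\<in>UNIV. F g x * F x h)
          + \<omega>\<^sup>2 * (\<Sum>x\<in>UNIV. F g x * of_bool (x = - h)) + \<omega> ^ 3 * (\<Sum>x\<in>UNIV. F g x * F x (- h))) / 4"
      by (simp only: sum.distrib flip: sum_distrib_left sum_divide_distrib)
    also have "\<dots> = (F g h + \<omega> * of_bool (g = - h) + \<omega>\<^sup>2 * F g (- h) + \<omega> ^ 3 * of_bool (g = h)) / 4"
      by (simp add: FF of_bool_def if_distrib cong: if_cong)
    also have "\<dots> = \<omega> ^ 3 * e g h"
    proof -
      have *: "\<omega> ^ 3 * \<omega> = 1" "\<omega> ^ 3 * \<omega>\<^sup>2 = \<omega>" "\<omega> ^ 3 * \<omega> ^ 3 = \<omega>\<^sup>2"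
        using w by algebra+
      show ?thesis
        by (simp add: e_def distrib_left * w5 w6 flip: mult.assoc)
    qed
    finally show ?thesis .
  qed
  have e_minus: "e (- g) h = \<omega>\<^sup>2 * e g h" for g h
  proof -
    have *: "\<omega>\<^sup>2 * \<omega> = \<omega> ^ 3" "\<omega>\<^sup>2 * \<omega>\<^sup>2 = 1" "\<omega>\<^sup>2 * \<omega> ^ 3 = \<omega>"
      using w w5 by (simp add: power2_eq_square power3_eq_cube, simp_all flip: power_add)
    have "F (- g) h = F g (- h)" "F (- g) (- h) = F g h"
      by (simp_all add: F_def B_minus_left B_minus_right)
    then show ?thesis
      by (simp add: e_def distrib_left * w w5 minus_equation_iff[of g] eq_commute[of "- h"] flip: mult.assoc)
  qed
  have "(\<Sum>x\<in>UNIV. e g x * e x h) = e g h" for g h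
  proof -
    have F_minus: "F g (- x) = F (- g) x" for x
      by (simp add: F_def B_minus_left B_minus_right)
    have "g = - x \<longleftrightarrow> x = - g" for x
      by auto
    then have "(\<Sum>x\<in>UNIV. e g x * e x h) =
        (\<Sum>x\<in>UNIV. (of_bool (g = x) * e x h + \<omega> * (F g x * e x h)
          + \<omega>\<^sup>2 * (of_bool (x = - g) * e x h) + \<omega> ^ 3 * (F (- g) x * e x h)) / 4)"
      by (intro sum.cong refl) (simp add: e_def[of g] F_minus algebra_simps)
    also have "\<dots> =
        ((\<Sum>x\<in>UNIV. of_bool (g = x) * e x h) + \<omega> * (\<Sum>x\<in>UNIV. F g x * e x h)
          + \<omega>\<^sup>2 * (\<Sum>x\<in>UNIV. of_bool (x = - g) * e x h) + \<omega> ^ 3 * (\<Sum>x\<in>UNIV. F (- g) x * e x h)) / 4"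
      by (simp only: sum.distrib flip: sum_distrib_left sum_divide_distrib)
    also have "\<dots> = (e g h + \<omega> * (\<omega> ^ 3 * e g h) + \<omega>\<^sup>2 * e (- g) h + \<omega> ^ 3 * (\<omega> ^ 3 * e (- g) h)) / 4"
      by (simp add: Fe of_bool_def if_distrib if_distribR cong: if_cong)
    also have "\<dots> = e g h"
    proof -
      have "\<omega> * \<omega> ^ 3 = 1"
        using w by algebra
      then show ?thesis
        unfolding e_minus using w by (simp add: w5 w6 field_simps)
    qed
    finally show ?thesis .
  qed
  then obtain r where "(\<Sum>g\<in>UNIV. e g g) = of_nat r"
    using idempotent_trace_nat[of e] by blast
  moreover have "4 * (\<Sum>g\<in>UNIV. e g g) = of_nat CARD('g) + \<omega> * ((\<Sum>g\<in>UNIV. B g g) / sqrt CARD('g))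
      + \<omega>\<^sup>2 * of_nat (card (two_torsion :: 'g set))
      + \<omega> ^ 3 * (cnj (\<Sum>g\<in>UNIV. B g g) / sqrt CARD('g))"
  proof -
    \<comment> \<open>The trace of the permutation \<open>g \<mapsto> - g\<close> counts its fixed
      points, the two-torsion elements.\<close>
    have "(\<Sum>g\<in>(UNIV :: 'g set). of_bool (g = - g)) = complex_of_nat (card (two_torsion :: 'g set))"
    proof -
      have "g = - g \<longleftrightarrow> g \<in> two_torsion" for g :: 'g
        unfolding two_torsion_def using eq_neg_iff_add_eq_0[of g g] by simp
      then show ?thesis by simp
    qed
    moreover have "4 * (\<Sum>g\<in>UNIV. e g g) = (\<Sum>g\<in>UNIV. 1 + \<omega> * (B g g / sqrt CARD('g))
        + \<omega>\<^sup>2 * of_bool (g = - g) + \<omega> ^ 3 * (cnj (B g g) / sqrt CARD('g)))"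
      unfolding sum_distrib_left by (intro sum.cong refl) (simp add: e_def F_def B_minus_right mult_ac)
    ultimately show ?thesis
      by (simp only: sum.distrib cnj_sum flip: sum_distrib_left sum_divide_distrib) simp
  qed
  ultimately show ?thesis by metis
qed

text \<open>The projections for \<open>\<omega> = 1\<close> and \<open>\<omega> = - \<i>\<close> determine the real and imaginary parts of the trace
  of the discrete Fourier transform.\<close>

lemma sum_B_self_parity:
  obtains x y M N :: int
  where "(\<Sum>g\<in>UNIV. B g g) = complex_of_real (sqrt CARD('g)) * Complex (of_int x) (of_int y) / 2"
    and "x = 4 * M - int CARD('g) - int (card (two_torsion :: 'g set))"
    and "y = 4 * N - int CARD('g) + int (card (two_torsion :: 'g set))"
proof -
  let ?n = "CARD('g)" and ?k = "card (two_torsion :: 'g set)"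
  define E where "E = (\<Sum>g\<in>UNIV. B g g) / complex_of_real (sqrt ?n)"
  have cE: "cnj (\<Sum>g\<in>UNIV. B g g) / complex_of_real (sqrt ?n) = cnj E"
    by (simp add: E_def)
  have i4: "(- \<i>) ^ 4 = 1" and i3: "(- \<i>) ^ 3 = \<i>"
    by (simp_all add: eval_nat_numeral)
  obtain M :: nat where M: "of_nat ?n + E + of_nat ?k + cnj E = 4 * of_nat M"
    using dft_projection_trace[of 1] unfolding cE E_def[symmetric] by auto
  obtain N :: nat where N: "of_nat ?n - \<i> * E - of_nat ?k + \<i> * cnj E = 4 * of_nat N"
    using dft_projection_trace[OF i4] unfolding cE E_def[symmetric] i3 by auto
  define x y where "x = 4 * int M - int ?n - int ?k" and "y = 4 * int N - int ?n + int ?k"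
  have "2 * Re E = of_int x"
    using arg_cong[OF M, of Re] by (simp add: x_def)
  moreover have "2 * Im E = of_int y"
    using arg_cong[OF N, of Re] by (simp add: y_def)
  ultimately have "E = Complex (of_int x) (of_int y) / 2"
    by (simp add: complex_eq_iff)
  then have "(\<Sum>g\<in>UNIV. B g g) = complex_of_real (sqrt ?n) * Complex (of_int x) (of_int y) / 2"
    by (simp add: E_def field_simps)
  then show thesis using x_def y_def by (rule that)
qed

text \<open>Squaring the trace value and comparing with \<open>square_sum_B_self\<close> gives the
  first equation; its norm gives the second, as the Gauss sum has norm one.\<close>

lemma gauss_sum_square_parity:
  obtains x y M N :: int
  where "Complex (of_int x) (of_int y) ^ 2 = 4 * (gauss_sum q)\<^sup>2 * (\<Sum>k\<in>two_torsion. B k k)"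
    and "real_of_int (x\<^sup>2 + y\<^sup>2) = 4 * norm (\<Sum>k\<in>two_torsion. B k k)"
    and "x = 4 * M - int CARD('g) - int (card (two_torsion :: 'g set))"
    and "y = 4 * N - int CARD('g) + int (card (two_torsion :: 'g set))"
proof -
  obtain x y M N :: int
    where E: "(\<Sum>g\<in>UNIV. B g g) = complex_of_real (sqrt CARD('g)) * Complex (of_int x) (of_int y) / 2"
    and xy: "x = 4 * M - int CARD('g) - int (card (two_torsion :: 'g set))"
      "y = 4 * N - int CARD('g) + int (card (two_torsion :: 'g set))"
    by (rule sum_B_self_parity)
  have sq: "Complex (of_int x) (of_int y) ^ 2 = 4 * (gauss_sum q)\<^sup>2 * (\<Sum>k\<in>two_torsion. B k k)"
  proof -
    have "(\<Sum>g\<in>UNIV. B g g)\<^sup>2 = of_nat CARD('g) * Complex (of_int x) (of_int y) ^ 2 / 4"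
      unfolding E by (simp add: power_mult_distrib power_divide flip: of_real_power)
    then have "4 * (gauss_sum q)\<^sup>2 * (\<Sum>k\<in>two_torsion. B k k) = Complex (of_int x) (of_int y) ^ 2"
      unfolding square_sum_B_self by (simp add: mult_ac)
    then show ?thesis ..
  qed
  have "real_of_int (x\<^sup>2 + y\<^sup>2) = norm (Complex (of_int x) (of_int y) ^ 2)"
    by (simp add: norm_power cmod_power2)
  also have "\<dots> = 4 * norm (\<Sum>k\<in>two_torsion. B k k)"
    by (simp add: sq norm_mult norm_power norm_gauss_sum)
  finally show thesis using sq xy that by blast
qed

text \<open>Here \<open>x\<^sup>2 + y\<^sup>2 = 4\<close>, and one of \<open>x\<close>,
  \<open>y\<close> is divisible by 4, hence zero. Which one depends on the order modulo 4 and
  decides the sign.\<close>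

lemma gauss_sum_square_odd:
  assumes K: "(two_torsion :: 'g set) = {0}" and odd: "odd CARD('g)"
  shows "(gauss_sum q)\<^sup>2 = (if CARD('g) mod 4 = 1 then 1 else - 1)"
proof -
  obtain x y M N :: int
    where c: "Complex (of_int x) (of_int y) ^ 2 = 4 * (gauss_sum q)\<^sup>2 * (\<Sum>k\<in>{0}. B k k)"
      and norm: "real_of_int (x\<^sup>2 + y\<^sup>2) = 4 * norm (\<Sum>k\<in>{0}. B k k)"
      and x: "x = 4 * M - int CARD('g) - int (card {0 :: 'g})"
      and y: "y = 4 * N - int CARD('g) + int (card {0 :: 'g})"
    by (rule gauss_sum_square_parity[unfolded K])
  note c = c[simplified] and x = x[simplified] and y = y[simplified]
  have norm: "real_of_int (x\<^sup>2 + y\<^sup>2) = 4"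
    using norm by simp
  then have norm': "x\<^sup>2 + y\<^sup>2 = 4"
    by linarith
  have small: "z = 0" if "4 dvd z" "z\<^sup>2 \<le> 4" for z :: int
  proof (rule ccontr)
    assume "z \<noteq> 0"
    with that(1) have "\<bar>4\<bar> \<le> \<bar>z\<bar>"
      by (rule dvd_imp_le_int[rotated])
    then have "4\<^sup>2 \<le> z\<^sup>2"
      by (subst abs_le_square_iff[symmetric])
    with that(2) show False by simp
  qed
  consider "CARD('g) mod 4 = 1" | "CARD('g) mod 4 = 3"
  proof -
    have "odd n \<Longrightarrow> n mod 4 = 1 \<or> n mod 4 = 3" for n :: nat
      by presburger
    with odd that show ?thesis by blast
  qed
  then show ?thesis
  proof cases
    case 1
    then have "4 dvd y" unfolding y by presburger
    then have "y = 0" using norm' zero_le_power2[of x] by (intro small) linarith+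
    with norm have "real_of_int x ^ 2 = 4" by simp
    with c 1 \<open>y = 0\<close> show ?thesis
      by (auto simp: complex_eq_iff power2_eq_square)
  next
    case 2
    then have "4 dvd x" unfolding x by presburger
    then have "x = 0" using norm' zero_le_power2[of y] by (intro small) linarith+
    with norm have "real_of_int y ^ 2 = 4" by simp
    with c 2 \<open>x = 0\<close> show ?thesis
      by (auto simp: complex_eq_iff power2_eq_square)
  qed
qed

text \<open>If the square were \<open>- 1\<close>, then \<open>(x + \<i> y)\<^sup>2\<close> would be
  real and at most zero, forcing \<open>x = 0\<close>; but \<open>x\<close> is 2 modulo 4.\<close>

lemma gauss_sum_square_two_torsion_two:
  assumes K: "(two_torsion :: 'g set) = {0, k}" and k: "k \<noteq> 0" and n: "4 dvd CARD('g)"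
  shows "(gauss_sum q)\<^sup>2 \<noteq> - 1"
proof
  assume c1: "(gauss_sum q)\<^sup>2 = - 1"
  obtain x y M N :: int
    where c: "Complex (of_int x) (of_int y) ^ 2 = 4 * (- 1) * (\<Sum>k\<in>{0, k}. B k k)"
      and norm: "real_of_int (x\<^sup>2 + y\<^sup>2) = 4 * norm (\<Sum>k\<in>{0, k}. B k k)"
      and x: "x = 4 * M - int CARD('g) - int (card {0, k})"
      and y: "y = 4 * N - int CARD('g) + int (card {0, k})"
    by (rule gauss_sum_square_parity[unfolded K c1])
  have sum: "(\<Sum>k\<in>{0, k}. B k k) = 1 + B k k" and card: "card {0, k} = 2"
    using k by auto
  have "x \<noteq> 0"
    using n unfolding x card by presburger
  then have "real_of_int x ^ 2 > 0" by simp
  moreover have "real_of_int x ^ 2 - real_of_int y ^ 2 = - real_of_int (x\<^sup>2 + y\<^sup>2)"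
  proof -
    have "k \<in> two_torsion" by (simp add: K)
    then have "B k k = 1 \<or> B k k = - 1" by (rule B_two_torsion_cases)
    then show ?thesis
      using arg_cong[OF c, of Re] norm unfolding sum by (auto simp: power2_eq_square)
  qed
  ultimately show False by simp
qed

section \<open>Orthogonality for products of two and three even functions\<close>

lemma sum_B_plus_B: "(\<Sum>x\<in>UNIV. B g x + B (- g) x) = 2 * of_nat CARD('g) * of_bool (g = 0)"
  by (simp add: sum.distrib sum_B)

lemma sum_B_B: "(\<Sum>x\<in>UNIV. B g x * B h x) = of_nat CARD('g) * of_bool (g + h = 0)"
  by (simp add: sum_B flip: B_add_left)

lemma sum_B_B_B:
  "(\<Sum>x\<in>UNIV. B g x * B h x * B l x) = of_nat CARD('g) * of_bool (g + h + l = 0)"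
  by (simp add: sum_B flip: B_add_left)

lemma sum_B_mult_B_plus_B:
  "(\<Sum>x\<in>UNIV. B k x * (B g x + B (- g) x)) = of_nat CARD('g) * (of_bool (k + g = 0) + of_bool (k = g))"
  by (simp add: distrib_left sum.distrib sum_B flip: B_add_left)

lemma sum_B_B_mult_B_plus_B:
  "(\<Sum>x\<in>UNIV. B k x * B l x * (B g x + B (- g) x))
    = of_nat CARD('g) * (of_bool (k + l + g = 0) + of_bool (k + l = g))"
  using sum_B_mult_B_plus_B[of "k + l" g] by (simp add: B_add_left)

text \<open>As for cosines, the product of the functions of \<open>g\<close> and \<open>h\<close> is
  the sum of those of \<open>g + h\<close> and \<open>g - h\<close>.\<close>

lemma sum_B_plus_B_product:
  "(\<Sum>x\<in>UNIV. (B g x + B (- g) x) * (B h x + B (- h) x))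
    = 2 * of_nat CARD('g) * (of_bool (g + h = 0) + of_bool (g = h))"
proof -
  have "(B g x + B (- g) x) * (B h x + B (- h) x) = (B (g + h) x + B (- (g + h)) x) + (B (g - h) x + B (- (g - h)) x)"
    for x
    by (simp only: diff_conv_add_uminus minus_add B_add_left minus_minus) (simp add: algebra_simps)
  then show ?thesis
    by (simp only: sum.distrib sum_B_plus_B[unfolded sum.distrib]) (simp add: algebra_simps)
qed

text \<open>Since \<open>- k = k\<close>, the factor \<open>B k x\<close> only shifts
  \<open>g\<close> to \<open>k + g\<close>.\<close>

lemma sum_B_mult_B_plus_B_product:
  assumes "k \<in> two_torsion"
  shows "(\<Sum>x\<in>UNIV. B k x * (B g x + B (- g) x) * (B h x + B (- h) x))
    = 2 * of_nat CARD('g) * (of_bool (k + g + h = 0) + of_bool (k + g = h))"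
proof -
  have "B k x * (B g x + B (- g) x) = B (k + g) x + B (- (k + g)) x" for x
  proof -
    have "- (k + g) = k + - g"
      using minus_two_torsion[OF assms] by simp
    then show ?thesis
      by (simp only: B_add_left distrib_left)
  qed
  then show ?thesis
    by (simp only: sum_B_plus_B_product)
qed

lemma sum_B_plus_B_triple_product:
  "(\<Sum>x\<in>UNIV. (B g x + B (- g) x) * (B h x + B (- h) x) * (B l x + B (- l) x))
    = 2 * of_nat CARD('g) * (of_bool (g + h + l = 0) + of_bool (g + h = l)
        + of_bool (g - h + l = 0) + of_bool (g - h = l))"
proof -
  have "(B g x + B (- g) x) * (B h x + B (- h) x) * (B l x + B (- l) x) =
      (B (g + h) x + B (- (g + h)) x) * (B l x + B (- l) x) + (B (g - h) x + B (- (g - h)) x) * (B l x + B (- l) x)"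
    for x
    by (simp only: diff_conv_add_uminus minus_add B_add_left minus_minus) (simp add: algebra_simps)
  then show ?thesis
    by (simp only: sum.distrib sum_B_plus_B_product) (simp add: algebra_simps)
qed

end

section \<open>The Verlinde formula\<close>

text \<open>Up to the factor \<open>- a\<close> (halved in the rows of \<open>J\<^sub>1\<close>), \<open>chi q1 i\<close> is column \<open>i\<close> of \<open>S'\<close> on the rows in
  \<open>J\<^sub>1\<close> and \<open>G\<^sub>*\<close>, without its \<open>\<delta>\<close>-terms, which are kept in \<open>rho q1 i\<close>. Its value at \<open>0\<close>
  serves the rows \<open>0\<close> and \<open>\<pi>\<close>.\<close>

fun chi :: "('g::ab_group_add \<Rightarrow> complex) \<Rightarrow> ('g, 'h) ix \<Rightarrow> 'g \<Rightarrow> complex" where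
  "chi q Ix_0 x = - 1"
| "chi q Ix_pi x = 1"
| "chi q (Ix_K k \<epsilon>) x = pairing q k x"
| "chi q (Ix_G g) x = pairing q g x + pairing q (- g) x"
| "chi q (Ix_Gamma \<gamma>) x = 0"

text \<open>Column \<open>i\<close> on the rows in \<open>\<Gamma>s\<close>, with the factor
  \<open>b\<close> removed. Rows 0 and \<pi> are half of \<open>b * psi\<close> plus or minus
  \<open>a * chi\<close>, both taken at zero.\<close>

fun psi :: "('h::ab_group_add \<Rightarrow> complex) \<Rightarrow> ('g, 'h) ix \<Rightarrow> 'h \<Rightarrow> complex" where
  "psi q Ix_0 x = 1"
| "psi q Ix_pi x = 1"
| "psi q (Ix_K k \<epsilon>) x = 0"
| "psi q (Ix_G g) x = 0"
| "psi q (Ix_Gamma \<gamma>) x = pairing q \<gamma> x + pairing q (- \<gamma>) x"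

fun rho :: "('g::ab_group_add \<Rightarrow> complex) \<Rightarrow> ('g, 'h) ix \<Rightarrow> 'g \<Rightarrow> complex" where
  "rho q (Ix_K k \<epsilon>) x = of_int \<epsilon> * q k * of_bool (x = k)"
| "rho q _ x = 0"

lemma sum_half_system:
  fixes f :: "'a::{finite,ab_group_add} \<Rightarrow> complex"
  assumes S: "half_system K S" and even: "\<And>x. f (- x) = f x"
  shows "sum f UNIV = sum f K + 2 * sum f S"
proof -
  have "sum f UNIV = sum f (K \<union> S \<union> uminus ` S)"
    using S by (simp add: half_system_def)
  also have "\<dots> = sum f K + sum f S + sum f (uminus ` S)"
    using S by (subst sum.union_disjoint; simp add: half_system_def sum.union_disjoint Int_Un_distrib2)
  also have "sum f (uminus ` S) = sum f S"
    by (simp add: sum.reindex even)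
  finally show ?thesis by simp
qed

lemma index_set_iff:
  "Ix_0 \<in> index_set Gs \<Gamma>s" "Ix_pi \<in> index_set Gs \<Gamma>s"
  "Ix_K k \<epsilon> \<in> index_set Gs \<Gamma>s \<longleftrightarrow> k \<in> two_torsion \<and> k \<noteq> 0 \<and> \<epsilon> \<in> {1, -1}"
  "Ix_G g \<in> index_set Gs \<Gamma>s \<longleftrightarrow> g \<in> Gs"
  "Ix_Gamma \<gamma> \<in> index_set Gs \<Gamma>s \<longleftrightarrow> \<gamma> \<in> \<Gamma>s"
  by (auto simp: index_set_def)

lemma sum_index_set:
  fixes Gs :: "'g::{finite,ab_group_add} set" and \<Gamma>s :: "'h::{finite,ab_group_add} set"
    and f :: "('g, 'h) ix \<Rightarrow> complex"
  shows "sum f (index_set Gs \<Gamma>s) = f Ix_0 + f Ix_pi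
    + (\<Sum>k\<in>two_torsion - {0}. f (Ix_K k 1) + f (Ix_K k (- 1)))
    + (\<Sum>g\<in>Gs. f (Ix_G g)) + (\<Sum>\<gamma>\<in>\<Gamma>s. f (Ix_Gamma \<gamma>))"
proof -
  let ?K = "(\<lambda>(k, \<epsilon>). Ix_K k \<epsilon> :: ('g, 'h) ix) ` ((two_torsion - {0}) \<times> {1, - 1})"
  have J: "index_set Gs \<Gamma>s = {Ix_0, Ix_pi} \<union> ?K \<union> Ix_G ` Gs \<union> Ix_Gamma ` \<Gamma>s"
    by (auto simp: index_set_def)
  have "sum f ?K = (\<Sum>(k, \<epsilon>)\<in>(two_torsion - {0}) \<times> {1, - 1}. f (Ix_K k \<epsilon>))"
    by (subst sum.reindex) (auto simp: inj_on_def case_prod_unfold)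
  also have "\<dots> = (\<Sum>k\<in>two_torsion - {0}. f (Ix_K k 1) + f (Ix_K k (- 1)))"
    by (simp flip: sum.cartesian_product)
  finally have K: "sum f ?K = (\<Sum>k\<in>two_torsion - {0}. f (Ix_K k 1) + f (Ix_K k (- 1)))" .
  have disj1: "({Ix_0, Ix_pi} \<union> ?K \<union> Ix_G ` Gs) \<inter> Ix_Gamma ` \<Gamma>s = {}"
    and disj2: "({Ix_0, Ix_pi} \<union> ?K) \<inter> Ix_G ` Gs = {}" and disj3: "{Ix_0, Ix_pi} \<inter> ?K = {}"
    by auto
  have fin: "finite {Ix_0, Ix_pi}" "finite ?K" "finite (Ix_G ` Gs)" "finite (Ix_Gamma ` \<Gamma>s)"
    by (auto intro!: finite_cartesian_product)
  have "sum f (index_set Gs \<Gamma>s) =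
      sum f {Ix_0, Ix_pi} + sum f ?K + sum f (Ix_G ` Gs) + sum f (Ix_Gamma ` \<Gamma>s)"
    unfolding J
    by (simp only: sum.union_disjoint[OF _ _ disj1] sum.union_disjoint[OF _ _ disj2]
      sum.union_disjoint[OF _ _ disj3] fin finite_Un)
  then show ?thesis
    unfolding K by (simp add: sum.reindex inj_on_def)
qed

text \<open>Contribution of the rows 0 and \<pi>. The two extra terms are the values at zero that
  complete the sums over the other rows to full group sums; with them, everything collapses to one
  product.\<close>

lemma verlinde_partial_fractions:
  fixes a b u1 u2 u3 v1 v2 v3 :: complex
  assumes "a\<^sup>2 \<noteq> b\<^sup>2"
  shows "(a * u1 + b * v1) / 2 * ((a * u2 + b * v2) / 2) * ((a * u3 + b * v3) / 2) / ((- a + b) / 2)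
    + (- a * u1 + b * v1) / 2 * ((- a * u2 + b * v2) / 2) * ((- a * u3 + b * v3) / 2) / ((a + b) / 2)
    + a\<^sup>2 / 2 * (u1 * u2 * u3) - b\<^sup>2 / 2 * (v1 * v2 * v3)
    = a\<^sup>2 * b\<^sup>2 / (b\<^sup>2 - a\<^sup>2) / 2 * ((u1 + v1) * (u2 + v2) * (u3 + v3))"
proof -
  have 1: "b - a \<noteq> 0" "a + b \<noteq> 0" "b\<^sup>2 - a\<^sup>2 = (b - a) * (a + b)"
    using assms by (auto simp: power2_eq_square algebra_simps add_eq_0_iff2)
  have "4 * b - 4 * a = 4 * (b - a)" "4 * a + 4 * b = 4 * (a + b)"
    by simp_all
  with 1 have "4 * b - 4 * a \<noteq> 0" "4 * a + 4 * b \<noteq> 0" "b \<noteq> a"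
    by (metis mult_eq_0_iff zero_neq_numeral, metis mult_eq_0_iff zero_neq_numeral, auto)
  then show ?thesis
    unfolding 1(3) using 1(1,2) by (simp add: divide_simps) algebra
qed

section \<open>Verlinde numbers as character sums\<close>

locale metric_pair = G: metric_grp q1 + H: metric_grp q2
  for q1 :: "'g::{finite,ab_group_add} \<Rightarrow> complex"
    and q2 :: "'h::{finite,ab_group_add} \<Rightarrow> complex" +
  fixes c :: complex and Gs :: "'g set" and \<Gamma>s :: "'h set"
  assumes Gs: "half_system two_torsion Gs" and \<Gamma>s: "half_system {0} \<Gamma>s"
begin

lemma S_entry_eq:
  "S_entry a b c q1 q2 Ix_0 i = (a * chi q1 i 0 + b * psi q2 i 0) / 2"
  "S_entry a b c q1 q2 Ix_pi i = (- a * chi q1 i 0 + b * psi q2 i 0) / 2"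
  "k \<in> two_torsion \<Longrightarrow>
    S_entry a b c q1 q2 (Ix_K k \<epsilon>) i = - (a * chi q1 i k + c * of_int \<epsilon> * rho q1 i k) / 2"
  "S_entry a b c q1 q2 (Ix_G g) i = - a * chi q1 i g"
  "S_entry a b c q1 q2 (Ix_Gamma \<gamma>) i = b * psi q2 i \<gamma>"
proof -
  assume k: "k \<in> two_torsion"
  have "pairing q1 (- g) k = pairing q1 g k" for g
    using G.B_minus_minus[of g k] G.minus_two_torsion[OF k] by simp
  then show "S_entry a b c q1 q2 (Ix_K k \<epsilon>) i = - (a * chi q1 i k + c * of_int \<epsilon> * rho q1 i k) / 2"
    by (cases i) (simp_all add: G.B_commute[of k])
qed (cases i; simp add: G.B_minus_left H.B_minus_left G.B_commute[of g] H.B_commute[of \<gamma>])+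

lemma cnj_B_two_torsion: "k \<in> two_torsion \<Longrightarrow> cnj (G.B k x) = G.B k x"
  using G.B_two_torsion_cases[of k x] by auto

lemma chi_even: "i \<in> index_set Gs \<Gamma>s \<Longrightarrow> chi q1 i (- x) = chi q1 i x"
  by (cases i) (simp_all add: index_set_iff G.B_minus_left G.B_minus_right cnj_B_two_torsion)

lemma psi_even: "psi q2 i (- x) = psi q2 i x"
  by (cases i) (simp_all add: H.B_minus_left H.B_minus_right)

definition chi_sum :: "('g, 'h) ix \<Rightarrow> ('g, 'h) ix \<Rightarrow> ('g, 'h) ix \<Rightarrow> complex" where
  "chi_sum i j k = (\<Sum>x\<in>UNIV. chi q1 i x * chi q1 j x * chi q1 k x)"

definition psi_sum :: "('g, 'h) ix \<Rightarrow> ('g, 'h) ix \<Rightarrow> ('g, 'h) ix \<Rightarrow> complex" where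
  "psi_sum i j k = (\<Sum>x\<in>UNIV. psi q2 i x * psi q2 j x * psi q2 k x)"

definition rho_sum :: "('g, 'h) ix \<Rightarrow> ('g, 'h) ix \<Rightarrow> ('g, 'h) ix \<Rightarrow> complex" where
  "rho_sum i j k = (\<Sum>x\<in>two_torsion - {0}. rho q1 i x * rho q1 j x * chi q1 k x)"

lemma verlinde_eq:
  assumes i: "i \<in> index_set Gs \<Gamma>s" and j: "j \<in> index_set Gs \<Gamma>s" and k: "k \<in> index_set Gs \<Gamma>s"
    and ne: "CARD('g) \<noteq> CARD('h)"
  shows "verlinde (index_set Gs \<Gamma>s) (S_matrix c q1 q2) Ix_0 i j k =
    (chi q1 i 0 + psi q2 i 0) * (chi q1 j 0 + psi q2 j 0) * (chi q1 k 0 + psi q2 k 0)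
        / (2 * (of_nat CARD('g) - of_nat CARD('h)))
    - chi_sum i j k / (2 * of_nat CARD('g)) + psi_sum i j k / (2 * of_nat CARD('h))
    - c\<^sup>2 / 2 * (rho_sum i j k + rho_sum i k j + rho_sum j k i)"
proof -
  let ?n = "of_nat CARD('g) :: complex" and ?m = "of_nat CARD('h) :: complex"
  define a where "a = 1 / complex_of_real (sqrt (real CARD('g)))"
  define b where "b = 1 / complex_of_real (sqrt (real CARD('h)))"
  have a2: "a\<^sup>2 = 1 / ?n" and b2: "b\<^sup>2 = 1 / ?m"
    by (simp_all add: a_def b_def power_divide flip: of_real_power)
  have a0: "a \<noteq> 0" and b0: "b \<noteq> 0"
    by (simp_all add: a_def b_def)
  have ab: "a\<^sup>2 \<noteq> b\<^sup>2"
    using ne by (simp add: a2 b2)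
  \<comment> \<open>The left side is the inverse of \<open>1 / a\<^sup>2 - 1 / b\<^sup>2\<close>,
    the difference of the group orders.\<close>
  have nu: "a\<^sup>2 * b\<^sup>2 / (b\<^sup>2 - a\<^sup>2) = 1 / (?n - ?m)"
    using ne by (simp add: a2 b2 divide_simps)
  have S: "S_matrix c q1 q2 = S_entry a b c q1 q2"
    by (simp add: S_matrix_def a_def b_def)
  define X where "X x = chi q1 i x * chi q1 j x * chi q1 k x" for x
  define Y where "Y x = psi q2 i x * psi q2 j x * psi q2 k x" for x
  define R where "R x = rho q1 i x * rho q1 j x * chi q1 k x
        + rho q1 i x * rho q1 k x * chi q1 j x + rho q1 j x * rho q1 k x * chi q1 i x" for x
  define f where "f w = S_entry a b c q1 q2 w i * S_entry a b c q1 q2 w j * S_entry a b c q1 q2 w k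
      / S_entry a b c q1 q2 Ix_0 w" for w
  \<comment> \<open>Adding the two signs cancels the odd powers of \<epsilon>; the quadratic ones
    survive as the \<open>c\<^sup>2\<close> term.\<close>
  have fK: "f (Ix_K x 1) + f (Ix_K x (- 1)) = - (a\<^sup>2 / 2) * X x - c\<^sup>2 / 2 * R x"
    if "x \<in> two_torsion" for x
    using a0 by (simp add: f_def S_entry_eq(3)[OF that] X_def R_def field_simps) algebra
  have fG: "f (Ix_G g) = - a\<^sup>2 * X g" for g
    using a0 by (simp add: f_def S_entry_eq(4) X_def power2_eq_square)
  have fH: "f (Ix_Gamma \<gamma>) = b\<^sup>2 * Y \<gamma>" for \<gamma>
    using b0 by (simp add: f_def S_entry_eq(5) Y_def power2_eq_square)
  have sum_X: "sum X UNIV = X 0 + sum X (two_torsion - {0}) + 2 * sum X Gs"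
  proof -
    have "sum X UNIV = sum X two_torsion + 2 * sum X Gs"
      by (rule sum_half_system[OF Gs]) (simp add: X_def chi_even i j k)
    moreover have "sum X two_torsion = X 0 + sum X (two_torsion - {0})"
      by (rule sum.remove) (auto simp: two_torsion_def)
    ultimately show ?thesis by simp
  qed
  have sum_Y: "sum Y UNIV = Y 0 + 2 * sum Y \<Gamma>s"
    by (subst sum_half_system[OF \<Gamma>s]) (simp_all add: Y_def psi_even)
  have "verlinde (index_set Gs \<Gamma>s) (S_matrix c q1 q2) Ix_0 i j k = sum f (index_set Gs \<Gamma>s)"
    by (simp add: verlinde_def S f_def)
  also have "\<dots> = f Ix_0 + f Ix_pi + (- (a\<^sup>2 / 2) * sum X (two_torsion - {0}) - c\<^sup>2 / 2 * sum R (two_torsion - {0}))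
      + (- a\<^sup>2 * sum X Gs) + b\<^sup>2 * sum Y \<Gamma>s"
    by (simp only: sum_index_set fG fH flip: sum_distrib_left)
       (simp add: fK sum_subtractf sum_negf flip: sum_distrib_left sum_divide_distrib)
  also have "\<dots> = (f Ix_0 + f Ix_pi + a\<^sup>2 / 2 * X 0 - b\<^sup>2 / 2 * Y 0) - a\<^sup>2 / 2 * sum X UNIV
      + b\<^sup>2 / 2 * sum Y UNIV - c\<^sup>2 / 2 * sum R (two_torsion - {0})"
    unfolding sum_X sum_Y by (simp add: field_simps)
  also have "f Ix_0 + f Ix_pi + a\<^sup>2 / 2 * X 0 - b\<^sup>2 / 2 * Y 0 = a\<^sup>2 * b\<^sup>2 / (b\<^sup>2 - a\<^sup>2) / 2 *
      ((chi q1 i 0 + psi q2 i 0) * (chi q1 j 0 + psi q2 j 0) * (chi q1 k 0 + psi q2 k 0))"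
  proof -
    have "S_entry a b c q1 q2 Ix_0 Ix_0 = (- a + b) / 2" "S_entry a b c q1 q2 Ix_0 Ix_pi = (a + b) / 2"
      by simp_all
    then show ?thesis
      unfolding f_def X_def Y_def S_entry_eq(1,2)[of _ _ i] S_entry_eq(1,2)[of _ _ j]
        S_entry_eq(1,2)[of _ _ k]
      using verlinde_partial_fractions[OF ab] by simp
  qed
  finally show ?thesis
    unfolding nu
    by (simp add: a2 b2 X_def Y_def R_def chi_sum_def psi_sum_def rho_sum_def sum.distrib
        mult.commute[of 2 "of_nat x" for x])
qed

end

text \<open>Two distinct nonzero elements \<open>x\<close>, \<open>y\<close> of a four-element
  \<open>K\<close> have \<open>x + y\<close> as the fourth element, which fixes the addition
  table.\<close>

lemma add_isomorphic_klein_four: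
  fixes K :: "'a::ab_group_add set"
  assumes add: "\<And>x y. x \<in> K \<Longrightarrow> y \<in> K \<Longrightarrow> x + y \<in> K"
    and double: "\<And>x. x \<in> K \<Longrightarrow> x + x = 0"
  shows "add_isomorphic K (UNIV :: (bit \<times> bit) set) \<longleftrightarrow> card K = 4"
proof
  have UNIV_bit: "(UNIV :: bit set) = {0, 1}"
    by (auto simp: bit_not_zero_iff)
  have UNIV2: "(UNIV :: (bit \<times> bit) set) = {(0, 0), (0, 1), (1, 0), (1, 1)}"
    unfolding UNIV_Times_UNIV[symmetric] UNIV_bit by auto
  {
    assume "add_isomorphic K (UNIV :: (bit \<times> bit) set)"
    then show "card K = 4"
      unfolding add_isomorphic_def UNIV2 by (auto dest!: bij_betw_same_card)
  }
  assume K4: "card K = 4"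
  have fin: "finite K"
    using K4 card.infinite by fastforce
  have "\<not> K \<subseteq> {0}"
    using card_mono[of "{0}" K] K4 by auto
  then obtain x where x: "x \<in> K" "x \<noteq> 0"
    by auto
  have "\<not> K \<subseteq> {0, x}"
    using card_mono[of "{0, x}" K] x K4 by auto
  then obtain y where y: "y \<in> K" "y \<noteq> 0" "y \<noteq> x"
    by auto
  have xx: "x + x = 0" "y + y = 0"
    using double x y by auto
  have xxz: "x + (x + z) = z" "y + (y + z) = z" for z
    using xx by (simp_all flip: add.assoc)
  have yx: "y + (x + z) = x + (y + z)" "y + x = x + y" for z
    by (rule add.left_commute, rule add.commute)
  have xy: "x + y \<noteq> 0" "x + y \<noteq> x" "x + y \<noteq> y"
    using x y xx by (auto simp: add_eq_0_iff)
  have K: "K = {0, x, y, x + y}"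
  proof (rule card_subset_eq[symmetric])
    show "{0, x, y, x + y} \<subseteq> K"
      using x y add double[of x] by (metis empty_subsetI insert_subset)
    show "card {0, x, y, x + y} = card K"
      using x y xy K4 by (auto simp: card_insert_if)
  qed (rule fin)
  define f :: "'a \<Rightarrow> bit \<times> bit"
    where "f z = (if z = x \<or> z = x + y then 1 else 0, if z = y \<or> z = x + y then 1 else 0)" for z
  have f: "f 0 = (0, 0)" "f x = (1, 0)" "f y = (0, 1)" "f (x + y) = (1, 1)"
    using x y xy by (auto simp: f_def)
  have "bij_betw f K UNIV"
    unfolding bij_betw_def UNIV2 K by (auto simp: inj_on_def f)
  moreover have "\<forall>u\<in>K. \<forall>v\<in>K. f (u + v) = f u + f v"
    unfolding K by (simp add: f xx xxz yx add.assoc zero_prod_def)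
  ultimately show "add_isomorphic K (UNIV :: (bit \<times> bit) set)"
    unfolding add_isomorphic_def by blast
qed

section \<open>Verlinde numbers at selected indices\<close>

context metric_pair
begin

lemma two_torsion_add: "k \<in> two_torsion \<Longrightarrow> l \<in> two_torsion \<Longrightarrow> k + l \<in> (two_torsion :: 'g set)"
  by (simp add: two_torsion_def algebra_simps)

text \<open>A nonzero \<open>x = - x\<close> would lie both in the half system and in its
  negative.\<close>

lemma two_torsion_H: "(two_torsion :: 'h set) = {0}"
proof -
  have "x = 0" if "x \<in> two_torsion" for x :: 'h
  proof (rule ccontr)
    assume "x \<noteq> 0"
    have minus: "- x = x"
      by (rule H.minus_two_torsion[OF that])
    have disj: "\<Gamma>s \<inter> uminus ` \<Gamma>s = {}"
      using \<Gamma>s unfolding half_system_def by (elim conjE)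
    have "x \<in> {0} \<union> \<Gamma>s \<union> uminus ` \<Gamma>s"
      using \<Gamma>s unfolding half_system_def by (metis UNIV_I)
    with \<open>x \<noteq> 0\<close> consider "x \<in> \<Gamma>s" | y where "y \<in> \<Gamma>s" "x = - y"
      by blast
    then show False
    proof cases
      case 1
      then have "- x \<in> uminus ` \<Gamma>s" by (rule imageI)
      with 1 disj show False unfolding minus by blast
    next
      case 2
      with minus have "x \<in> \<Gamma>s" by simp
      moreover have "x \<in> uminus ` \<Gamma>s" using 2 by simp
      ultimately show False using disj by blast
    qed
  qed
  moreover have "0 \<in> (two_torsion :: 'h set)"
    by (simp add: two_torsion_def)
  ultimately show ?thesis by blast
qed

lemma rho_sum_K:
  assumes "k \<in> two_torsion" "k \<noteq> 0"
  shows "rho_sum (Ix_K k \<epsilon>) (Ix_K k' \<epsilon>') l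
    = of_bool (k = k') * of_int (\<epsilon> * \<epsilon>') * G.B k k * chi q1 l k"
proof -
  have "rho_sum (Ix_K k \<epsilon>) (Ix_K k' \<epsilon>') l = (\<Sum>x\<in>two_torsion - {0}.
      if x = k then of_bool (k = k') * of_int (\<epsilon> * \<epsilon>') * G.B k k * chi q1 l k else 0)"
    unfolding rho_sum_def by (intro sum.cong refl) (auto simp: G.B_self power2_eq_square)
  then show ?thesis
    using assms by (simp add: sum.delta)
qed

text \<open>Distinct elements serve to bound the order of the two-torsion; a repeated element
  determines \<open>c\<^sup>2\<close>.\<close>

lemma verlinde_K_K_K:
  assumes k: "k1 \<in> two_torsion - {0}" "k2 \<in> two_torsion - {0}" "k3 \<in> two_torsion - {0}"
    and e: "\<epsilon>1 \<in> {1, -1}" "\<epsilon>2 \<in> {1, -1}" "\<epsilon>3 \<in> {1, -1}" and ne: "CARD('g) \<noteq> CARD('h)"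
  shows "verlinde (index_set Gs \<Gamma>s) (S_matrix c q1 q2) Ix_0 (Ix_K k1 \<epsilon>1) (Ix_K k2 \<epsilon>2) (Ix_K k3 \<epsilon>3) =
    1 / (2 * (of_nat CARD('g) - of_nat CARD('h))) - of_bool (k1 + k2 + k3 = 0) / 2
    - c\<^sup>2 / 2 * (of_bool (k1 = k2) * of_int (\<epsilon>1 * \<epsilon>2) * G.B k1 k1 * G.B k3 k1
       + of_bool (k1 = k3) * of_int (\<epsilon>1 * \<epsilon>3) * G.B k1 k1 * G.B k2 k1
       + of_bool (k2 = k3) * of_int (\<epsilon>2 * \<epsilon>3) * G.B k2 k2 * G.B k1 k2)"
proof -
  have "chi_sum (Ix_K k1 \<epsilon>1) (Ix_K k2 \<epsilon>2) (Ix_K k3 \<epsilon>3) = of_nat CARD('g) * of_bool (k1 + k2 + k3 = 0)"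
    by (simp add: chi_sum_def G.sum_B_B_B)
  moreover have "psi_sum (Ix_K k1 \<epsilon>1) (Ix_K k2 \<epsilon>2) (Ix_K k3 \<epsilon>3) = 0"
    by (simp add: psi_sum_def)
  ultimately show ?thesis
    using k e by (subst verlinde_eq) (simp_all add: index_set_iff ne rho_sum_K)
qed

text \<open>The two averages are both one and cancel, leaving \<open>2 ^ 3\<close> over twice the
  difference of the orders.\<close>

lemma verlinde_pi_pi_pi:
  assumes ne: "CARD('g) \<noteq> CARD('h)"
  shows "verlinde (index_set Gs \<Gamma>s) (S_matrix c q1 q2) Ix_0 Ix_pi Ix_pi Ix_pi =
    4 / (of_nat CARD('g) - of_nat CARD('h))"
  by (simp add: verlinde_eq index_set_iff ne chi_sum_def psi_sum_def rho_sum_def divide_simps)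

end

section \<open>Integrality when the two-torsion is a Klein four-group\<close>

locale klein_metric_pair = metric_pair q1 q2 c Gs \<Gamma>s
  for q1 :: "'g::{finite,ab_group_add} \<Rightarrow> complex"
    and q2 :: "'h::{finite,ab_group_add} \<Rightarrow> complex"
    and c Gs \<Gamma>s +
  assumes n: "CARD('g) = CARD('h) + 1" and K4: "card (two_torsion :: 'g set) = 4" and c2: "c\<^sup>2 = - 1"
begin

text \<open>The right side of \<open>verlinde_eq\<close> with order difference one and
  \<open>c\<^sup>2 = - 1\<close>.\<close>

definition N :: "('g, 'h) ix \<Rightarrow> ('g, 'h) ix \<Rightarrow> ('g, 'h) ix \<Rightarrow> complex" where
  "N i j k = (chi q1 i 0 + psi q2 i 0) * (chi q1 j 0 + psi q2 j 0) * (chi q1 k 0 + psi q2 k 0) / 2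
    - chi_sum i j k / (2 * of_nat CARD('g)) + psi_sum i j k / (2 * of_nat CARD('h))
    + (rho_sum i j k + rho_sum i k j + rho_sum j k i) / 2"

lemma N_commute: "N i j k = N j i k" "N i j k = N i k j"
  by (simp_all add: N_def chi_sum_def psi_sum_def rho_sum_def mult_ac add_ac)

lemma verlinde_eq_N:
  assumes "i \<in> index_set Gs \<Gamma>s" "j \<in> index_set Gs \<Gamma>s" "k \<in> index_set Gs \<Gamma>s"
  shows "verlinde (index_set Gs \<Gamma>s) (S_matrix c q1 q2) Ix_0 i j k = N i j k"
  using assms n by (simp add: verlinde_eq N_def c2)

lemma Gs_not_two_torsion: "g \<in> Gs \<Longrightarrow> g \<notin> two_torsion"
  using Gs by (auto simp: half_system_def)

lemma Gs_neq:
  assumes g: "g \<in> Gs" and k: "k \<in> two_torsion"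
  shows "k + g \<noteq> 0" "k \<noteq> g" "g \<noteq> 0"
proof -
  have "k + g = 0 \<Longrightarrow> g = k"
    using G.minus_two_torsion[OF k] by (metis minus_unique)
  then show "k + g \<noteq> 0" "k \<noteq> g" "g \<noteq> 0"
    using Gs_not_two_torsion[OF g] k by (auto simp: two_torsion_def)
qed

lemma \<Gamma>s_nonzero: "\<gamma> \<in> \<Gamma>s \<Longrightarrow> \<gamma> \<noteq> 0"
  using \<Gamma>s by (auto simp: half_system_def)

lemma rho_sum_simps [simp]:
  "rho_sum Ix_0 i j = 0" "rho_sum i Ix_0 j = 0" "rho_sum Ix_pi i j = 0" "rho_sum i Ix_pi j = 0"
  "rho_sum (Ix_G g) i j = 0" "rho_sum i (Ix_G g) j = 0"
  "rho_sum (Ix_Gamma \<gamma>) i j = 0" "rho_sum i (Ix_Gamma \<gamma>) j = 0"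
  by (simp_all add: rho_sum_def)

text \<open>\<open>Ix_0\<close> is traded for \<open>Ix_pi\<close> with a sign; what is left counts
  vanishing signed sums of labels by orthogonality.\<close>

lemma chi_sum_simps [simp]:
  "chi_sum Ix_0 i j = - chi_sum Ix_pi i j"
  "chi_sum Ix_pi Ix_0 j = - chi_sum Ix_pi Ix_pi j"
  "chi_sum Ix_pi Ix_pi Ix_0 = - of_nat CARD('g)"
  "chi_sum Ix_pi Ix_pi Ix_pi = of_nat CARD('g)"
  "chi_sum Ix_pi Ix_pi (Ix_K k \<epsilon>) = of_bool (k = 0) * of_nat CARD('g)"
  "chi_sum Ix_pi Ix_pi (Ix_G g) = 2 * of_nat CARD('g) * of_bool (g = 0)"
  "chi_sum Ix_pi (Ix_K k \<epsilon>) (Ix_K k' \<epsilon>') = of_nat CARD('g) * of_bool (k + k' = 0)"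
  "chi_sum Ix_pi (Ix_K k \<epsilon>) (Ix_G g) = of_nat CARD('g) * (of_bool (k + g = 0) + of_bool (k = g))"
  "chi_sum Ix_pi (Ix_G g) (Ix_G g') = 2 * of_nat CARD('g) * (of_bool (g + g' = 0) + of_bool (g = g'))"
  "chi_sum (Ix_K k \<epsilon>) (Ix_K k' \<epsilon>') (Ix_K k'' \<epsilon>'') = of_nat CARD('g) * of_bool (k + k' + k'' = 0)"
  "chi_sum (Ix_K k \<epsilon>) (Ix_K k' \<epsilon>') (Ix_G g)
    = of_nat CARD('g) * (of_bool (k + k' + g = 0) + of_bool (k + k' = g))"
  "k \<in> two_torsion \<Longrightarrow> chi_sum (Ix_K k \<epsilon>) (Ix_G g) (Ix_G g')
    = 2 * of_nat CARD('g) * (of_bool (k + g + g' = 0) + of_bool (k + g = g'))"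
  "chi_sum (Ix_G g) (Ix_G g') (Ix_G g'') = 2 * of_nat CARD('g) * (of_bool (g + g' + g'' = 0)
     + of_bool (g + g' = g'') + of_bool (g - g' + g'' = 0) + of_bool (g - g' = g''))"
  "chi_sum i j (Ix_Gamma \<gamma>) = 0"
  unfolding chi_sum_def chi.simps
  by (simp_all only: mult_1_left mult_minus_left mult_minus_right mult_1_right sum_negf
      sum_constant of_nat_1 minus_minus G.sum_B G.sum_B_plus_B G.sum_B_B G.sum_B_B_B G.sum_B_mult_B_plus_B
      G.sum_B_B_mult_B_plus_B G.sum_B_plus_B_product G.sum_B_mult_B_plus_B_product
      G.sum_B_plus_B_triple_product mult_zero_right sum.neutral_const)

lemma psi_sum_simps [simp]:
  "psi_sum Ix_0 i j = psi_sum Ix_pi i j"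
  "psi_sum Ix_pi Ix_0 j = psi_sum Ix_pi Ix_pi j"
  "psi_sum Ix_pi Ix_pi Ix_0 = of_nat CARD('h)"
  "psi_sum Ix_pi Ix_pi Ix_pi = of_nat CARD('h)"
  "psi_sum Ix_pi Ix_pi (Ix_Gamma \<gamma>) = 2 * of_nat CARD('h) * of_bool (\<gamma> = 0)"
  "psi_sum Ix_pi (Ix_Gamma \<gamma>) (Ix_Gamma \<gamma>') = 2 * of_nat CARD('h) * (of_bool (\<gamma> + \<gamma>' = 0) + of_bool (\<gamma> = \<gamma>'))"
  "psi_sum (Ix_Gamma \<gamma>) (Ix_Gamma \<gamma>') (Ix_Gamma \<gamma>'') = 2 * of_nat CARD('h) * (of_bool (\<gamma> + \<gamma>' + \<gamma>'' = 0)
     + of_bool (\<gamma> + \<gamma>' = \<gamma>'') + of_bool (\<gamma> - \<gamma>' + \<gamma>'' = 0) + of_bool (\<gamma> - \<gamma>' = \<gamma>''))"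
  "psi_sum (Ix_K k \<epsilon>) i j = 0" "psi_sum i (Ix_K k \<epsilon>) j = 0" "psi_sum i j (Ix_K k \<epsilon>) = 0"
  "psi_sum (Ix_G g) i j = 0" "psi_sum i (Ix_G g) j = 0" "psi_sum i j (Ix_G g) = 0"
  by (simp_all add: psi_sum_def H.sum_B_plus_B H.sum_B_plus_B_product H.sum_B_plus_B_triple_product)

lemma two_torsion_add_eq_0:
  "k \<in> two_torsion \<Longrightarrow> k + k = (0 :: 'g)"
  "k \<in> two_torsion \<Longrightarrow> k' \<in> two_torsion \<Longrightarrow> k + k' = (0 :: 'g) \<longleftrightarrow> k = k'"
  using G.minus_two_torsion[of k'] by (simp_all add: two_torsion_def flip: eq_neg_iff_add_eq_0)

text \<open>The four elements exhaust the two-torsion, and the sum is none of 0, \<open>k1\<close>,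
  \<open>k2\<close>. This excludes the value 1/2 on three distinct labels.\<close>

lemma klein_add:
  assumes k: "k1 \<in> two_torsion" "k1 \<noteq> 0" "k2 \<in> two_torsion" "k2 \<noteq> 0" "k3 \<in> two_torsion" "k3 \<noteq> 0"
    and distinct: "k1 \<noteq> k2" "k1 \<noteq> k3" "k2 \<noteq> k3"
  shows "k1 + k2 = (k3 :: 'g)"
proof -
  have "{0, k1, k2, k3} = two_torsion"
  proof (rule card_subset_eq)
    show "{0, k1, k2, k3} \<subseteq> two_torsion"
      using k by (auto simp: two_torsion_def)
    show "card {0, k1, k2, k3} = card (two_torsion :: 'g set)"
      using k distinct K4 by auto
  qed simp
  then have "k1 + k2 \<in> {0, k1, k2, k3}"
    using k by (metis two_torsion_add)
  moreover have "k1 + k2 \<noteq> 0"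
    using k distinct by (metis two_torsion_add_eq_0(2))
  ultimately show ?thesis
    using k by simp
qed

lemma B_minus_two_torsion: "k \<in> two_torsion \<Longrightarrow> G.B (- g) k = G.B g k"
  using G.B_minus_minus[of g k] G.minus_two_torsion[of k] by simp

context
  fixes k l :: 'g and \<epsilon> \<epsilon>' :: int
  assumes k: "k \<in> two_torsion" and e: "\<epsilon> = 1 \<or> \<epsilon> = - 1" "\<epsilon>' = 1 \<or> \<epsilon>' = - 1"
begin

text \<open>The values left over at indices with a repeated element of the two-torsion: every
  product is a sign, so the halves combine to 0 or 1 and the last value is 0 or 2.\<close>

lemma signs_in_Nats:
  "1 / 2 - of_int \<epsilon> * of_int \<epsilon>' * G.B k k / 2 \<in> \<nat>"
  "1 / 2 + of_int \<epsilon> * of_int \<epsilon>' * G.B k k / 2 \<in> \<nat>"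
  "1 / 2 + of_int \<epsilon> * of_int \<epsilon>' * G.B k k * G.B l k / 2 \<in> \<nat>"
  "1 + of_int \<epsilon> * (of_int \<epsilon>' * (G.B k k * G.B l k)) \<in> \<nat>"
  using G.B_two_torsion_cases[OF k, of k] G.B_two_torsion_cases[OF k, of l] e
  by (auto simp: G.B_commute[of l])

text \<open>The pairwise products of three signs add up to 3 or - 1, so the value is 2 or 0.\<close>

lemma three_signs_in_Nats:
  assumes "\<epsilon>'' = 1 \<or> \<epsilon>'' = - 1"
  shows "1 / 2 + (of_int \<epsilon> * of_int \<epsilon>' * G.B k k * G.B k k + of_int \<epsilon> * of_int \<epsilon>'' * G.B k k * G.B k k
    + of_int \<epsilon>' * of_int \<epsilon>'' * G.B k k * G.B k k) / 2 \<in> \<nat>"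
  using G.B_two_torsion_cases[OF k, of k] e assms by auto

end

lemma Gs_nonzero: "g \<in> Gs \<Longrightarrow> g \<noteq> 0"
  using Gs_neq(3)[of g 0] by (simp add: two_torsion_def)

fun ix_rank :: "('a, 'b) ix \<Rightarrow> nat" where
  "ix_rank Ix_0 = 0" | "ix_rank Ix_pi = 1" | "ix_rank (Ix_K k \<epsilon>) = 2" | "ix_rank (Ix_G g) = 3"
| "ix_rank (Ix_Gamma \<gamma>) = 4"

text \<open>\<open>N\<close> is symmetric, so triples sorted by block suffice; each case is a count
  of label coincidences.\<close>

lemma N_sorted:
  assumes "i \<in> index_set Gs \<Gamma>s" "j \<in> index_set Gs \<Gamma>s" "k \<in> index_set Gs \<Gamma>s"
    "ix_rank i \<le> ix_rank j" "ix_rank j \<le> ix_rank k"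
  shows "N i j k \<in> \<nat>"
  using assms
  by (cases i; cases j; cases k; simp add: N_def index_set_iff rho_sum_K Gs_neq Gs_nonzero \<Gamma>s_nonzero
     two_torsion_add two_torsion_add_eq_0 signs_in_Nats three_signs_in_Nats B_minus_two_torsion;
      auto intro: klein_add)

lemma N_in_Nats:
  assumes "i \<in> index_set Gs \<Gamma>s" "j \<in> index_set Gs \<Gamma>s" "k \<in> index_set Gs \<Gamma>s"
  shows "N i j k \<in> \<nat>"
proof -
  consider "ix_rank i \<le> ix_rank j" "ix_rank j \<le> ix_rank k" | "ix_rank i \<le> ix_rank k" "ix_rank k \<le> ix_rank j"
    | "ix_rank j \<le> ix_rank i" "ix_rank i \<le> ix_rank k" | "ix_rank j \<le> ix_rank k" "ix_rank k \<le> ix_rank i"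
    | "ix_rank k \<le> ix_rank i" "ix_rank i \<le> ix_rank j" | "ix_rank k \<le> ix_rank j" "ix_rank j \<le> ix_rank i"
    by linarith
  then show ?thesis
    by cases (use N_sorted assms N_commute in metis)+
qed

end

section \<open>Integrality\<close>

lemma half_notin_Nats: "(1 / 2 :: complex) \<notin> \<nat>"
proof
  assume "(1 / 2 :: complex) \<in> \<nat>"
  then obtain r :: nat where "(1 / 2 :: complex) = of_nat r" by (auto elim: Nats_cases)
  then have "of_nat (2 * r) = (of_nat 1 :: complex)" by (simp add: field_simps)
  then show False unfolding of_nat_eq_iff by presburger
qed

text \<open>An odd divisor of 4 is 1 or - 1, and the quotient being natural excludes - 1.\<close>

lemma nat_diff_eq_1_if_four_divided:
  fixes n m :: nat
  assumes "odd (int n - int m)" and "4 / (of_nat n - of_nat m :: complex) \<in> \<nat>"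
  shows "n = m + 1"
proof -
  obtain r :: nat where r: "4 / (of_nat n - of_nat m :: complex) = of_nat r"
    using assms(2) by (auto elim: Nats_cases)
  have "n \<noteq> m" using assms(1) by auto
  then have "(of_int (int r * (int n - int m)) :: complex) = of_int 4"
    using r by (simp add: field_simps)
  then have eq: "int r * (int n - int m) = 4"
    by (simp only: of_int_eq_iff)
  then have "int n - int m dvd 2 * 2"
    by (metis dvd_triv_right mult_2 numeral_Bit0)
  then have "int n - int m dvd 1"
    using assms(1) by (metis coprime_dvd_mult_right_iff coprime_right_2_iff_odd dvd_trans mult.right_neutral)
  then have "int n - int m = 1 \<or> int n - int m = - 1"
    by auto
  with eq show ?thesis by auto
qed

context metric_pair
begin

lemma not_all_Nats_if_two_torsion_gt_4:
  assumes n: "CARD('g) = CARD('h) + 1" and K: "card (two_torsion :: 'g set) > 4"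
  shows "\<exists>i\<in>index_set Gs \<Gamma>s. \<exists>j\<in>index_set Gs \<Gamma>s. \<exists>k\<in>index_set Gs \<Gamma>s.
    verlinde (index_set Gs \<Gamma>s) (S_matrix c q1 q2) Ix_0 i j k \<notin> \<nat>"
proof -
  have ex: "\<exists>x. x \<in> two_torsion - A" if "card A \<le> 4" for A :: "'g set"
    using card_mono[of A two_torsion] that K by (metis Diff_iff finite linorder_not_less order_trans subsetI)
  have card_le: "card {0, x, y, z :: 'g} \<le> 4" for x y z
    by (simp add: card_insert_if)
  obtain x where x: "x \<in> two_torsion" "x \<noteq> (0 :: 'g)"
    using ex[of "{0}"] by auto
  obtain y where y: "y \<in> two_torsion" "y \<noteq> 0" "y \<noteq> x"
    using ex[OF card_le[of x x x]] by auto
  \<comment> \<open>Avoiding \<open>x + y\<close> as well keeps \<open>x + y + z\<close> nonzero;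
    this is where more than four elements are needed.\<close>
  obtain z where z: "z \<in> two_torsion" "z \<noteq> 0" "z \<noteq> x" "z \<noteq> y" "z \<noteq> x + y"
    using ex[OF card_le[of x y "x + y"]] by auto
  have "x + y + z \<noteq> 0"
    using z(5) G.minus_two_torsion[OF z(1)] by (metis eq_neg_iff_add_eq_0)
  then have "verlinde (index_set Gs \<Gamma>s) (S_matrix c q1 q2) Ix_0 (Ix_K x 1) (Ix_K y 1) (Ix_K z 1) = 1 / 2"
    using x y z n by (subst verlinde_K_K_K) auto
  then have "verlinde (index_set Gs \<Gamma>s) (S_matrix c q1 q2) Ix_0 (Ix_K x 1) (Ix_K y 1) (Ix_K z 1) \<notin> \<nat>"
    using half_notin_Nats by (simp only: not_False_eq_True)
  moreover have "Ix_K x 1 \<in> index_set Gs \<Gamma>s" "Ix_K y 1 \<in> index_set Gs \<Gamma>s" "Ix_K z 1 \<in> index_set Gs \<Gamma>s"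
    using x y z by (auto simp: index_set_iff)
  ultimately show ?thesis by blast
qed

text \<open>The signs (1, 1, - 1) give \<open>(1 + c\<^sup>2) / 2\<close>, which makes
  \<open>c\<^sup>2\<close> real and so 1 or - 1. The signs (1, 1, 1) give
  \<open>(1 - 3 c\<^sup>2) / 2\<close>, which is - 1 if \<open>c\<^sup>2 = 1\<close>.\<close>

lemma square_eq_minus_1_if_Nats:
  fixes k :: 'g
  assumes n: "CARD('g) = CARD('h) + 1" and k: "k \<in> two_torsion" "k \<noteq> 0" and c: "norm c = 1"
    and N: "\<And>i j k. i \<in> index_set Gs \<Gamma>s \<Longrightarrow> j \<in> index_set Gs \<Gamma>s \<Longrightarrow> k \<in> index_set Gs \<Gamma>s \<Longrightarrow>
      verlinde (index_set Gs \<Gamma>s) (S_matrix c q1 q2) Ix_0 i j k \<in> \<nat>"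
  shows "c\<^sup>2 = - 1"
proof -
  have J: "Ix_K k 1 \<in> index_set Gs \<Gamma>s" "Ix_K k (- 1) \<in> index_set Gs \<Gamma>s"
    using k by (simp_all add: index_set_iff)
  have kk: "k + k = 0"
    using k by (simp add: two_torsion_def)
  have B: "G.B k k * G.B k k = 1"
    using G.B_two_torsion_cases[OF k(1), of k] by auto
  have "verlinde (index_set Gs \<Gamma>s) (S_matrix c q1 q2) Ix_0 (Ix_K k 1) (Ix_K k 1) (Ix_K k 1)
      = 1 / 2 - 3 / 2 * c\<^sup>2"
    using k n kk B by (subst verlinde_K_K_K) (auto simp: algebra_simps)
  then obtain r :: nat where r: "1 / 2 - 3 / 2 * c\<^sup>2 = of_nat r"
    using N[OF J(1) J(1) J(1)] by (metis Nats_cases)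
  have "verlinde (index_set Gs \<Gamma>s) (S_matrix c q1 q2) Ix_0 (Ix_K k 1) (Ix_K k 1) (Ix_K k (- 1))
      = 1 / 2 + 1 / 2 * c\<^sup>2"
    using k n kk B by (subst verlinde_K_K_K) (auto simp: algebra_simps)
  then obtain s :: nat where s: "1 / 2 + 1 / 2 * c\<^sup>2 = of_nat s"
    using N[OF J(1) J(1) J(2)] by (metis Nats_cases)
  have c2: "c\<^sup>2 = of_real (2 * real s - 1)"
    using s by (simp add: field_simps)
  have "norm (c\<^sup>2) = 1"
    using c by (simp add: norm_power)
  then have "\<bar>2 * real s - 1\<bar> = 1"
    unfolding c2 by (simp only: norm_of_real)
  then have "s = 0 \<or> s = 1"
    by linarith
  moreover have "s \<noteq> 1"
  proof
    assume "s = 1"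
    have "of_nat (r + 1) = 1 / 2 - 3 / 2 * c\<^sup>2 + 1"
      by (simp only: r of_nat_add of_nat_1)
    also have "\<dots> = 0"
      using c2 \<open>s = 1\<close> by simp
    finally show False
      unfolding of_nat_eq_0_iff by simp
  qed
  ultimately show ?thesis
    using c2 by simp
qed

end

theorem theorem7p4:
  fixes q1 :: "'g::{finite,ab_group_add} \<Rightarrow> complex"
    and q2 :: "'h::{finite,ab_group_add} \<Rightarrow> complex"
    and c :: complex
    and Gs :: "'g set" and \<Gamma>s :: "'h set"
  assumes "metric_group q1" and "metric_group q2"
    and "even CARD('g)" and "odd CARD('h)"
    and "c = gauss_sum q1" and "c = - gauss_sum q2"
    and "half_system two_torsion Gs" and "half_system {0} \<Gamma>s"
  defines "J \<equiv> index_set Gs \<Gamma>s"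
  shows "(\<forall>i\<in>J. \<forall>j\<in>J. \<forall>k\<in>J. verlinde J (S_matrix c q1 q2) Ix_0 i j k \<in> \<nat>) \<longleftrightarrow>
         CARD('h) = CARD('g) - 1 \<and>
         add_isomorphic (two_torsion :: 'g set) (UNIV :: (bit \<times> bit) set)"
proof -
  interpret metric_pair q1 q2 c Gs \<Gamma>s
    using assms by unfold_locales
  have iso: "add_isomorphic (two_torsion :: 'g set) (UNIV :: (bit \<times> bit) set)
      \<longleftrightarrow> card (two_torsion :: 'g set) = 4"
    by (rule add_isomorphic_klein_four[OF two_torsion_add]) (simp_all add: two_torsion_def)
  \<comment> \<open>The opposite signs of the two Gauss sums disappear on squaring, so the order of
    \<Gamma> alone decides \<open>c\<^sup>2\<close>.\<close>
  have c2: "c\<^sup>2 = (if CARD('h) mod 4 = 1 then 1 else - 1)"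
    using H.gauss_sum_square_odd[OF two_torsion_H assms(4)] assms(6) by simp
  show ?thesis
    unfolding iso
  proof
    assume "\<forall>i\<in>J. \<forall>j\<in>J. \<forall>k\<in>J. verlinde J (S_matrix c q1 q2) Ix_0 i j k \<in> \<nat>"
    then have N: "\<And>i j k. i \<in> index_set Gs \<Gamma>s \<Longrightarrow> j \<in> index_set Gs \<Gamma>s \<Longrightarrow> k \<in> index_set Gs \<Gamma>s \<Longrightarrow>
        verlinde (index_set Gs \<Gamma>s) (S_matrix c q1 q2) Ix_0 i j k \<in> \<nat>"
      by (simp add: J_def)
    have "CARD('g) \<noteq> CARD('h)"
      using assms(3,4) by metis
    then have "4 / (of_nat CARD('g) - of_nat CARD('h) :: complex) \<in> \<nat>"
      using N[of Ix_pi Ix_pi Ix_pi] by (simp add: verlinde_pi_pi_pi index_set_iff)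
    then have n: "CARD('g) = CARD('h) + 1"
      using assms(3,4) by (intro nat_diff_eq_1_if_four_divided) simp_all
    have le4: "card (two_torsion :: 'g set) \<le> 4"
      using not_all_Nats_if_two_torsion_gt_4[OF n] N by (meson not_le)
    have "card (two_torsion :: 'g set) \<noteq> 0"
      by (auto simp: two_torsion_def card_eq_0_iff intro: exI[of _ 0])
    \<comment> \<open>The complement of the two-torsion splits into pairs, so only the orders 2 and
      4 remain.\<close>
    moreover have even: "even (card (two_torsion :: 'g set))"
      using card_half_system[OF assms(7)] assms(3) by simp
    moreover have "card (two_torsion :: 'g set) \<noteq> 2"
    proof
      assume K2: "card (two_torsion :: 'g set) = 2"
      obtain k where K: "(two_torsion :: 'g set) = {0, k}" and k: "k \<noteq> 0"
      proof -
        have "0 \<in> (two_torsion :: 'g set)" by (simp add: two_torsion_def)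
        moreover obtain x y where xy: "(two_torsion :: 'g set) = {x, y}" "x \<noteq> y"
          using K2 by (auto simp: card_2_iff)
        ultimately have "x = 0 \<or> y = 0" by auto
        then show ?thesis
          using that[of x] that[of y] xy by (auto simp: insert_commute)
      qed
      have "k \<in> two_torsion"
        unfolding K by simp
      then have c1: "c\<^sup>2 = - 1"
        using square_eq_minus_1_if_Nats[OF n _ k _ N] G.norm_gauss_sum assms(5) by simp
      then have "CARD('h) mod 4 \<noteq> 1"
        using c2 by auto
      then have "4 dvd CARD('g)"
        using n assms(4) by presburger
      then show False
        using G.gauss_sum_square_two_torsion_two[OF K k] c1 assms(5) by simp
    qed
    ultimately have "card (two_torsion :: 'g set) = 4"
      using le4 by presburger
    with n show "CARD('h) = CARD('g) - 1 \<and> card (two_torsion :: 'g set) = 4"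
      by simp
  next
    assume R: "CARD('h) = CARD('g) - 1 \<and> card (two_torsion :: 'g set) = 4"
    then have n: "CARD('g) = CARD('h) + 1" by simp
    \<comment> \<open>The order of \<Gamma> is then 3 modulo 4, which gives the value
      \<open>c\<^sup>2 = - 1\<close> required by the Klein case.\<close>
    have "4 dvd CARD('g)"
      using card_two_torsion_dvd[where 'a = 'g] R by simp
    then have "CARD('h) mod 4 \<noteq> 1"
      using n by presburger
    then have c1: "c\<^sup>2 = - 1"
      using c2 by simp
    have "card (two_torsion :: 'g set) = 4"
      using R by (rule conjunct2)
    then interpret klein_metric_pair q1 q2 c Gs \<Gamma>s
      using n c1 by unfold_locales
    show "\<forall>i\<in>J. \<forall>j\<in>J. \<forall>k\<in>J. verlinde J (S_matrix c q1 q2) Ix_0 i j k \<in> \<nat>"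
      by (simp add: J_def verlinde_eq_N N_in_Nats)
  qed
qed

end
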